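(* Let $R$ be a finite-dimensional semisimple algebra with a set grading $\mathscr{R}\colon R=R_1\oplus\cdots\oplus R_m$. Suppose that: (i) $\mathscr{R}$ is a regular quantum commutative decomposition of $R$; (ii) $\mathscr{R}$ is minimal. Then $\mathscr{R}$ is a group grading by a finite abelian group $G$. Moreover, $m=\dim B_\ell$, where $B_\ell$ is a simple component of $R$, and $G\cong \mathbb{Z}_{n_1}^2\times\cdots\times\mathbb{Z}_{n_r}^2$ with $n_1\cdots n_r=\sqrt{\dim B_\ell}$.
   Context: $K$ is an algebraically closed field of characteristic different from $2$; all algebras are unital associative $K$-algebras. A set grading of $R$ by a set $S$ is a vector space decomposition $R=\bigoplus_{s\in S}R_s$ with all $R_s\neq\{0\}$ such that for all $s,t\in S$ either $R_sR_t=\{0\}$ or there exists $f(s,t)\in S$ with $R_sR_t\subseteq R_{f(s,t)}$. It is (realized as) a group grading by a group $G$ if $S$ can be identified with a subset of $G$ in such a way that, putting $R_g=\{0\}$ for $g\in G\setminus S$, one has $f(g,h)=gh$ whenever $g,h\in S$ and $f(g,h)$ is defined (that is, $R_gR_h\neq\{0\}$); so $R=\bigoplus_{g\in G}R_g$ is a $G$-grading. A regular quantum commutative decomposition of $R$, of quantum length $m$, is a vector space decomposition $R=R_1\oplus\cdots\oplus R_m$ such that, with $S=\{1,\dots,m\}$: (a) for every $n\in\mathbb{N}$ and every $(i_1,\dots,i_n)\in S^n$ there exist $a_j\in R_{i_j}$, $1\le j\le n$, with $a_1\cdots a_n\neq 0$; (b) there is a function $\theta\colon S\times S\to K^*$ such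 that $ab=\theta(i,j)ba$ for all $i,j\in S$, $a\in R_i$, $b\in R_j$. Its decomposition matrix is $M^R=(\theta(i,j))_{1\le i,j\le m}$, and it is minimal if no two columns (equivalently, rows) of $M^R$ with different indices are equal. *)

theory Defs
  imports
    "HOL-Computational_Algebra.Polynomial"
    "HOL-Algebra.Product_Groups"
begin

text \<open>
  The algebra is the whole type \<^typ>\<open>'a\<close>, with the scalars acting through \<open>scale\<close>. The class
  \<^class>\<open>ring_1\<close> includes \<open>0 \<noteq> 1\<close>, so the zero algebra, which has no simple components,
  is excluded.
\<close>

locale unital_algebra = vector_space scale
  for scale :: "'k::field \<Rightarrow> 'a::ring_1 \<Rightarrow> 'a" (infixr \<open>*s\<close> 75) +
  assumes scale_mult_left: "(c *s a) * b = c *s (a * b)"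
    and scale_mult_right: "a * (c *s b) = c *s (a * b)"
begin

text \<open>Finiteness of the index set is required because \<^const>\<open>sum\<close> is \<open>0\<close> on infinite sets.\<close>

definition direct_sum_decomposition :: "'i set \<Rightarrow> ('i \<Rightarrow> 'a set) \<Rightarrow> bool" where
  "direct_sum_decomposition S V \<longleftrightarrow>
     finite S \<and> (\<forall>s\<in>S. subspace (V s)) \<and>
     (\<forall>x. \<exists>!f. f \<in> (\<Pi>\<^sub>E s\<in>S. V s) \<and> x = (\<Sum>s\<in>S. f s))"

text \<open>Semisimplicity of the algebra as a left module over itself.\<close>

definition left_ideal :: "'a set \<Rightarrow> bool" where
  "left_ideal L \<longleftrightarrow> subspace L \<and> (\<forall>a. \<forall>x\<in>L. a * x \<in> L)"

definition semisimple :: bool where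
  "semisimple \<longleftrightarrow>
     (\<forall>L. left_ideal L \<longrightarrow>
        (\<exists>L'. left_ideal L' \<and> L \<inter> L' = {0} \<and> (\<forall>x. \<exists>y\<in>L. \<exists>z\<in>L'. x = y + z)))"

text \<open>
  \<open>ideal_of B I\<close>: \<open>I\<close> is a two-sided ideal of the (not necessarily unital) subalgebra \<open>B\<close>,
  so \<open>ideal_of UNIV\<close> describes the two-sided ideals of the algebra.
\<close>

definition ideal_of :: "'a set \<Rightarrow> 'a set \<Rightarrow> bool" where
  "ideal_of B I \<longleftrightarrow> subspace I \<and> I \<subseteq> B \<and> (\<forall>b\<in>B. \<forall>x\<in>I. b * x \<in> I \<and> x * b \<in> I)"

text \<open>
  The usual condition that the product of \<open>B\<close> is not identically zero is omitted:
  this is only applied to direct summands of a unital algebra, which are unital.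
\<close>

definition simple_ideal :: "'a set \<Rightarrow> bool" where
  "simple_ideal B \<longleftrightarrow>
     ideal_of UNIV B \<and> B \<noteq> {0} \<and> (\<forall>I. ideal_of B I \<longrightarrow> I = {0} \<or> I = B)"

definition simple_component :: "'a set \<Rightarrow> bool" where
  "simple_component C \<longleftrightarrow>
     (\<exists>k (B :: nat \<Rightarrow> 'a set). direct_sum_decomposition {1..k} B \<and>
        (\<forall>l\<in>{1..k}. simple_ideal (B l)) \<and> (\<exists>l\<in>{1..k}. C = B l))"

definition set_grading :: "'i set \<Rightarrow> ('i \<Rightarrow> 'a set) \<Rightarrow> bool" where
  "set_grading S R \<longleftrightarrow>
     direct_sum_decomposition S R \<and> (\<forall>s\<in>S. R s \<noteq> {0}) \<and>
     (\<forall>s\<in>S. \<forall>t\<in>S. (\<forall>a\<in>R s. \<forall>b\<in>R t. a * b = 0) \<or>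
        (\<exists>u\<in>S. \<forall>a\<in>R s. \<forall>b\<in>R t. a * b \<in> R u))"

text \<open>
  If \<open>R s R t \<noteq> 0\<close>, the index \<open>u\<close> with \<open>R s R t \<subseteq> R u\<close> is unique, namely \<open>u = f(s,t)\<close>.
  The map \<open>\<phi>\<close> is the identification of the index set with a subset of the group.
\<close>

definition group_grading :: "'i set \<Rightarrow> ('i \<Rightarrow> 'a set) \<Rightarrow> ('g, 'm) monoid_scheme \<Rightarrow> bool" where
  "group_grading S R G \<longleftrightarrow>
     set_grading S R \<and> group G \<and>
     (\<exists>\<phi>. inj_on \<phi> S \<and> \<phi> ` S \<subseteq> carrier G \<and>
        (\<forall>s\<in>S. \<forall>t\<in>S. \<forall>u\<in>S.
           (\<exists>a\<in>R s. \<exists>b\<in>R t. a * b \<noteq> 0) \<and> (\<forall>a\<in>R s. \<forall>b\<in>R t. a * b \<in> R u) \<longrightarrow>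
           \<phi> u = \<phi> s \<otimes>\<^bsub>G\<^esub> \<phi> t))"

text \<open>
  The matrix \<open>\<theta>\<close> is a parameter. The first condition below, for words of length two,
  makes its entries on \<open>S \<times> S\<close> unique.
\<close>

definition regular_quantum_commutative ::
    "'i set \<Rightarrow> ('i \<Rightarrow> 'a set) \<Rightarrow> ('i \<Rightarrow> 'i \<Rightarrow> 'k) \<Rightarrow> bool" where
  "regular_quantum_commutative S R \<theta> \<longleftrightarrow>
     direct_sum_decomposition S R \<and>
     (\<forall>is. set is \<subseteq> S \<longrightarrow>
        (\<exists>as. list_all2 (\<lambda>a i. a \<in> R i) as is \<and> prod_list as \<noteq> 0)) \<and>
     (\<forall>i\<in>S. \<forall>j\<in>S. \<theta> i j \<noteq> 0 \<and> (\<forall>a\<in>R i. \<forall>b\<in>R j. a * b = \<theta> i j *s (b * a)))"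

end

definition minimal_matrix :: "'i set \<Rightarrow> ('i \<Rightarrow> 'i \<Rightarrow> 'k) \<Rightarrow> bool" where
  "minimal_matrix S \<theta> \<longleftrightarrow> (\<forall>i\<in>S. \<forall>j\<in>S. i \<noteq> j \<longrightarrow> (\<exists>k\<in>S. \<theta> k i \<noteq> \<theta> k j))"

end

theory Submission
  imports Defs "HOL-Algebra.Multiplicative_Group"
begin

text \<open>
  Regularity makes all products \<open>R s R t R u\<close> nonzero. Hence the set of degrees is a finite
  commutative semigroup, and comparing the two ways of commuting \<open>c\<close> past \<open>a b\<close> shows that \<open>\<theta>\<close> is
  multiplicative in each argument. Minimality says that \<open>s \<mapsto> \<theta> s\<close> is injective; since the values
  of \<open>\<theta>\<close> are nonzero scalars, the semigroup is cancellative, so it is a finite abelian group \<open>G\<close> with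
  the nondegenerate bicharacter \<open>\<theta>\<close> (\<open>comm_group_degree_group\<close>).

  By semisimplicity every ideal is generated by a central idempotent
  (\<open>ideal_eq_corner\<close>), and therefore no nonzero ideal has square zero. If \<open>x\<close> is homogeneous, the left
  ideal \<open>A x\<close> equals \<open>x A\<close>, so \<open>x \<noteq> 0\<close> implies that no power of \<open>x\<close> vanishes
  (\<open>homogeneous_pow_nonzero\<close>). In particular \<open>x\<^sup>2 = \<theta> s s x\<^sup>2\<close> is nonzero, so \<open>\<theta>\<close> is alternating.

  Not every simple component has the dimension in question, so one has to be selected. Take a nonzero
  product \<open>w\<close> of homogeneous elements in which every degree occurs, and a central idempotent \<open>\<epsilon>\<close> of
  trivial degree with \<open>w \<epsilon> \<noteq> 0\<close> and \<open>dim (\<epsilon> A)\<close> minimal. As the scalars are algebraically closed,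
  the part of trivial degree of \<open>\<epsilon> A\<close> is the line \<open>K \<epsilon>\<close> (\<open>minimal_idempotent\<close>). A nonzero
  homogeneous element of \<open>\<epsilon> A\<close> has a nonzero power of trivial degree, so it is invertible in \<open>\<epsilon> A\<close>.
  Therefore all homogeneous parts of \<open>\<epsilon> A\<close> are lines, and \<open>\<epsilon> A\<close>, a twisted group algebra of \<open>G\<close> with
  commutation factors \<open>\<theta>\<close>, has dimension \<open>card G\<close>. It is simple because \<open>\<theta>\<close> is nondegenerate
  (\<open>simple_component_of_dim_card\<close>).

  It remains to see that a finite abelian group with a nondegenerate alternating bicharacter is a
  product of groups \<open>\<int>\<^sub>n \<times> \<int>\<^sub>n\<close>: a pair \<open>g, h\<close> for which \<open>\<theta> g h\<close> has maximal order generates such a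
  factor, its orthogonal complement is a direct complement, and induction applies
  (\<open>split_off_hyperbolic_pair\<close>). Counting elements gives the product of the numbers \<open>n\<^sub>i\<close>.
\<close>

section \<open>Elements of maximal order\<close>

lemma (in comm_group) ord_mult_coprime:
  assumes x: "x \<in> carrier G" and y: "y \<in> carrier G" and "coprime (ord x) (ord y)"
  shows "ord (x \<otimes> y) = ord x * ord y"
proof -
  have factor: "ord u dvd k"
    if u: "u \<in> carrier G" and v: "v \<in> carrier G" and cop: "coprime (ord u) (ord v)"
      and eq: "(u \<otimes> v) [^] k = \<one>" for u v and k :: nat
  proof -
    have "u [^] (k * ord v) = u [^] (k * ord v) \<otimes> v [^] (k * ord v)"
      using u v by (simp add: pow_eq_id)
    also have "\<dots> = ((u \<otimes> v) [^] k) [^] ord v"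
      using u v by (simp add: nat_pow_distrib nat_pow_pow)
    also have "\<dots> = \<one>"
      by (simp add: eq)
    finally have "ord u dvd k * ord v"
      using u by (simp add: pow_eq_id)
    then show ?thesis
      using cop by (simp add: coprime_dvd_mult_left_iff)
  qed
  have "(x \<otimes> y) [^] k = \<one> \<longleftrightarrow> ord x * ord y dvd k" for k :: nat
  proof
    assume eq: "(x \<otimes> y) [^] k = \<one>"
    have "ord x dvd k"
      using factor [OF x y assms(3) eq] .
    moreover have "ord y dvd k"
      using factor [OF y x] assms eq by (simp add: coprime_commute m_comm)
    ultimately show "ord x * ord y dvd k"
      using assms(3) by (simp add: divides_mult)
  next
    assume "ord x * ord y dvd k"
    then have "ord x dvd k" "ord y dvd k"
      by (auto dest: dvd_mult_left dvd_mult_right)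
    then show "(x \<otimes> y) [^] k = \<one>"
      using x y by (simp add: nat_pow_distrib pow_eq_id [symmetric])
  qed
  then show ?thesis
    using x y by (simp add: ord_unique)
qed

text \<open>
  If a prime \<open>p\<close> occurs in the order of \<open>b\<close> to a higher power than in that of \<open>a\<close>, then the
  \<open>p'\<close>-part of \<open>a\<close> times the \<open>p\<close>-part of \<open>b\<close> has larger order than \<open>a\<close>. Consequently an element
  of maximal order in a finite abelian group has the exponent of the group as its order.
\<close>

lemma (in comm_group) larger_ord_if_not_dvd:
  assumes a: "a \<in> carrier G" and b: "b \<in> carrier G" and "ord a > 0" and "ord b > 0"
    and ndvd: "\<not> ord b dvd ord a"
  obtains i j :: nat where "ord (a [^] i \<otimes> b [^] j) > ord a"
proof -
  have "\<exists>p. prime p \<and> multiplicity p (ord a) < multiplicity p (ord b)"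
  proof (rule ccontr)
    assume "\<nexists>p. prime p \<and> multiplicity p (ord a) < multiplicity p (ord b)"
    then have "ord b dvd ord a"
      using \<open>ord b > 0\<close> by (intro multiplicity_le_imp_dvd) (auto simp: not_less)
    with ndvd show False ..
  qed
  then obtain p where p: "prime p" and less: "multiplicity p (ord a) < multiplicity p (ord b)"
    by blast
  define i j where "i = multiplicity p (ord a)" and "j = multiplicity p (ord b)"
  obtain a' where a': "ord a = p ^ i * a'" "\<not> p dvd a'"
    using multiplicity_decompose' [of "ord a" p] p \<open>ord a > 0\<close> unfolding i_def
    by (metis not_prime_unit not_gr0)
  obtain b' where b': "ord b = p ^ j * b'" "\<not> p dvd b'"
    using multiplicity_decompose' [of "ord b" p] p \<open>ord b > 0\<close> unfolding j_def
    by (metis not_prime_unit not_gr0)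
  have pos: "p ^ i > 0" "b' > 0" "a' > 0"
    using a' b' p \<open>ord a > 0\<close> \<open>ord b > 0\<close> by (auto simp: prime_gt_0_nat)
  have 1: "ord (a [^] (p ^ i)) = a'"
    using ord_pow [OF a, of "p ^ i"] a' pos by simp
  have 2: "ord (b [^] b') = p ^ j"
    using ord_pow [OF b, of b'] b' pos by simp
  have "coprime a' (p ^ j)"
    using p a'(2) by (metis coprime_commute coprime_power_right_iff prime_imp_coprime)
  then have "ord (a [^] (p ^ i) \<otimes> b [^] b') = a' * p ^ j"
    using ord_mult_coprime [of "a [^] (p ^ i)" "b [^] b'"] a b 1 2 by simp
  moreover have "a' * p ^ j > ord a"
    using a' pos less prime_gt_1_nat [OF p] unfolding i_def [symmetric] j_def [symmetric]
    by (simp add: mult.commute)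
  ultimately show thesis
    using that by metis
qed

section \<open>Finite abelian groups with a nondegenerate alternating bicharacter\<close>

text \<open>Orders of roots of unity are their orders in this group.\<close>

definition field_units :: "'k::field monoid" where
  "field_units = \<lparr>carrier = - {0}, mult = (*), one = 1\<rparr>"

lemma field_units_simps [simp]:
  "carrier field_units = - {0}" "mult field_units = (*)" "one field_units = 1"
  by (simp_all add: field_units_def)

lemma comm_group_field_units: "comm_group (field_units :: 'k::field monoid)"
proof (rule comm_groupI)
  fix x :: 'k assume "x \<in> carrier field_units"
  then show "\<exists>y\<in>carrier field_units. y \<otimes>\<^bsub>field_units\<^esub> x = \<one>\<^bsub>field_units\<^esub>"
    by (intro bexI [of _ "inverse x"]) auto
qed auto

lemma field_units_pow [simp]: "z [^]\<^bsub>field_units\<^esub> (k::nat) = z ^ k"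
  by (induction k) (simp_all add: mult.commute)

lemma ord_field_units:
  fixes z :: "'k::field"
  shows "z \<noteq> 0 \<Longrightarrow> z ^ k = 1 \<longleftrightarrow> group.ord field_units z dvd k"
  using group.pow_eq_id [OF comm_group.axioms(2) [OF comm_group_field_units], of z k] by simp

text \<open>
  The \<open>n\<close> distinct powers of \<open>\<zeta>\<close> exhaust the roots of \<open>X ^ n - 1\<close>, whose number is at most \<open>n\<close>.
\<close>

lemma root_of_unity_is_power:
  fixes z \<zeta> :: "'k::field"
  assumes "\<zeta> \<noteq> 0" and n: "group.ord field_units \<zeta> = n" "n > 0" and z: "z ^ n = 1"
  obtains a where "a < n" "z = \<zeta> ^ a"
proof -
  define p :: "'k poly" where "p = Polynomial.monom 1 n - 1"
  have "Polynomial.coeff p n = 1"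
    using \<open>n > 0\<close> by (simp add: p_def)
  then have "p \<noteq> 0"
    by auto
  have "Polynomial.degree p \<le> n"
    unfolding p_def by (intro degree_diff_le) (auto simp: degree_monom_le)
  then have card: "card {x. poly p x = 0} \<le> n"
    using card_poly_roots_bound [OF \<open>p \<noteq> 0\<close>] by linarith
  have roots: "{x. poly p x = 0} = {x. x ^ n = 1}"
    by (auto simp: p_def poly_monom)
  have inj: "inj_on (\<lambda>a. \<zeta> ^ a) {..<n}"
  proof (rule linorder_inj_onI)
    fix a b assume ab: "a < b" "a \<in> {..<n}" "b \<in> {..<n}"
    show "\<zeta> ^ a \<noteq> \<zeta> ^ b"
    proof
      assume "\<zeta> ^ a = \<zeta> ^ b"
      then have "\<zeta> ^ (b - a) = 1"
        using ab \<open>\<zeta> \<noteq> 0\<close> by (simp add: power_diff)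
      then have "n dvd b - a"
        using ord_field_units [OF \<open>\<zeta> \<noteq> 0\<close>] n by simp
      then show False
        using ab by (auto dest: dvd_imp_le)
    qed
  qed auto
  have "\<zeta> ^ n = 1"
    using ord_field_units [OF \<open>\<zeta> \<noteq> 0\<close>] n by simp
  then have "(\<zeta> ^ a) ^ n = 1" for a
    by (metis mult.commute power_mult power_one)
  then have "(\<lambda>a. \<zeta> ^ a) ` {..<n} \<subseteq> {x. x ^ n = 1}"
    by auto
  moreover have "finite {x::'k. x ^ n = 1}"
    using poly_roots_finite [OF \<open>p \<noteq> 0\<close>] roots by simp
  moreover have "card ((\<lambda>a. \<zeta> ^ a) ` {..<n}) = n"
    using inj by (simp add: card_image)
  ultimately have "(\<lambda>a. \<zeta> ^ a) ` {..<n} = {x. x ^ n = 1}"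
    using card roots by (metis card_seteq)
  then show thesis
    using z that by auto
qed

locale alternating_bicharacter = comm_group G for G (structure) +
  fixes \<theta> :: "'a \<Rightarrow> 'a \<Rightarrow> 'k::field"
  assumes finite: "finite (carrier G)"
    and nonzero: "\<lbrakk>x \<in> carrier G; y \<in> carrier G\<rbrakk> \<Longrightarrow> \<theta> x y \<noteq> 0"
    and mult_left: "\<lbrakk>x \<in> carrier G; y \<in> carrier G; z \<in> carrier G\<rbrakk> \<Longrightarrow> \<theta> (x \<otimes> y) z = \<theta> x z * \<theta> y z"
    and skew: "\<lbrakk>x \<in> carrier G; y \<in> carrier G\<rbrakk> \<Longrightarrow> \<theta> x y * \<theta> y x = 1"
    and alternating: "x \<in> carrier G \<Longrightarrow> \<theta> x x = 1"
    and nondegenerate: "\<lbrakk>x \<in> carrier G; \<And>y. y \<in> carrier G \<Longrightarrow> \<theta> x y = 1\<rbrakk> \<Longrightarrow> x = \<one>"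
begin

lemma skew': "\<lbrakk>x \<in> carrier G; y \<in> carrier G\<rbrakk> \<Longrightarrow> \<theta> x y = inverse (\<theta> y x)"
  using skew [of x y] nonzero [of y x] by (metis inverse_unique mult.commute)

lemma mult_right:
  "\<lbrakk>x \<in> carrier G; y \<in> carrier G; z \<in> carrier G\<rbrakk> \<Longrightarrow> \<theta> z (x \<otimes> y) = \<theta> z x * \<theta> z y"
  by (simp add: skew' [of z] mult_left)

lemma one_left [simp]: "x \<in> carrier G \<Longrightarrow> \<theta> \<one> x = 1"
  using mult_left [of \<one> \<one> x] nonzero [of \<one> x] by simp

lemma one_right [simp]: "x \<in> carrier G \<Longrightarrow> \<theta> x \<one> = 1"
  by (simp add: skew' [of x])

lemma pow_left: "\<lbrakk>x \<in> carrier G; y \<in> carrier G\<rbrakk> \<Longrightarrow> \<theta> (x [^] (k::nat)) y = \<theta> x y ^ k"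
  by (induction k) (simp_all add: mult_left mult.commute)

lemma pow_right: "\<lbrakk>x \<in> carrier G; y \<in> carrier G\<rbrakk> \<Longrightarrow> \<theta> y (x [^] (k::nat)) = \<theta> y x ^ k"
  by (induction k) (simp_all add: mult_right mult.commute)

lemma inv_left: "\<lbrakk>x \<in> carrier G; y \<in> carrier G\<rbrakk> \<Longrightarrow> \<theta> (inv x) y = inverse (\<theta> x y)"
  using mult_left [of "inv x" x y] nonzero [of x y] by (simp add: field_simps)

lemma inv_right: "\<lbrakk>x \<in> carrier G; y \<in> carrier G\<rbrakk> \<Longrightarrow> \<theta> y (inv x) = inverse (\<theta> y x)"
  using mult_right [of "inv x" x y] nonzero [of y x] by (simp add: field_simps)

lemma ord_value_pos:
  assumes "x \<in> carrier G" "y \<in> carrier G"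
  shows "group.ord field_units (\<theta> x y) > 0"
proof -
  have "\<theta> x y ^ order G = 1"
    using pow_left [of x y "order G"] assms by (simp add: pow_order_eq_1)
  then have "group.ord field_units (\<theta> x y) dvd order G"
    using ord_field_units nonzero assms by blast
  moreover have "order G > 0"
    by (simp add: finite order_gt_0_iff_finite)
  ultimately show ?thesis
    by (auto intro: Nat.gr0I)
qed

text \<open>
  A pair with \<open>\<theta> g h\<close> of maximal order \<open>n\<close> among all values of \<open>\<theta>\<close>: the values \<open>\<theta> g y\<close> form
  a group, and so do the values \<open>\<theta> x h\<close>, hence their orders divide \<open>n\<close>. By nondegeneracy
  the orders of \<open>g\<close> and \<open>h\<close> divide \<open>n\<close> as well.
\<close>

lemma hyperbolic_pair:
  assumes nontrivial: "carrier G \<noteq> {\<one>}"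
  obtains g h n where "g \<in> carrier G" "h \<in> carrier G" "n > 1"
    and "group.ord field_units (\<theta> g h) = n"
    and "g [^] n = \<one>" "h [^] n = \<one>"
    and "\<And>y. y \<in> carrier G \<Longrightarrow> \<theta> g y ^ n = 1"
    and "\<And>x. x \<in> carrier G \<Longrightarrow> \<theta> x h ^ n = 1"
proof -
  let ?ord = "group.ord (field_units :: 'k monoid)"
  interpret U: comm_group "field_units :: 'k monoid"
    by (rule comm_group_field_units)
  let ?f = "\<lambda>(x, y). ?ord (\<theta> x y)"
  have fin: "finite (?f ` (carrier G \<times> carrier G))" "?f ` (carrier G \<times> carrier G) \<noteq> {}"
    using finite by auto
  have "Max (?f ` (carrier G \<times> carrier G)) \<in> ?f ` (carrier G \<times> carrier G)"
    using fin by (rule Max_in)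
  then obtain g h where g: "g \<in> carrier G" and h: "h \<in> carrier G"
    and Max: "?ord (\<theta> g h) = Max (?f ` (carrier G \<times> carrier G))"
    by auto
  have max: "?ord (\<theta> x y) \<le> ?ord (\<theta> g h)" if "x \<in> carrier G" "y \<in> carrier G" for x y
    unfolding Max using fin that by (intro Max_ge) auto
  define n where "n = ?ord (\<theta> g h)"
  have dvd_g: "?ord (\<theta> g y) dvd n" if y: "y \<in> carrier G" for y
  proof (rule ccontr)
    assume "\<not> ?ord (\<theta> g y) dvd n"
    then obtain i j :: nat where "?ord (\<theta> g h ^ i * \<theta> g y ^ j) > n"
      using U.larger_ord_if_not_dvd [of "\<theta> g h" "\<theta> g y"] g h y nonzero ord_value_pos
      unfolding n_def by auto
    moreover have "\<theta> g h ^ i * \<theta> g y ^ j = \<theta> g (h [^] i \<otimes> y [^] j)"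
      using g h y by (simp add: mult_right pow_right)
    ultimately show False
      using max [of g "h [^] i \<otimes> y [^] j"] g h y unfolding n_def by auto
  qed
  have dvd_h: "?ord (\<theta> x h) dvd n" if x: "x \<in> carrier G" for x
  proof (rule ccontr)
    assume "\<not> ?ord (\<theta> x h) dvd n"
    then obtain i j :: nat where "?ord (\<theta> g h ^ i * \<theta> x h ^ j) > n"
      using U.larger_ord_if_not_dvd [of "\<theta> g h" "\<theta> x h"] g h x nonzero ord_value_pos
      unfolding n_def by auto
    moreover have "\<theta> g h ^ i * \<theta> x h ^ j = \<theta> (g [^] i \<otimes> x [^] j) h"
      using g h x by (simp add: mult_left pow_left)
    ultimately show False
      using max [of "g [^] i \<otimes> x [^] j" h] g h x unfolding n_def by auto
  qed
  have 1: "\<theta> g y ^ n = 1" if "y \<in> carrier G" for y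
    using dvd_g [OF that] ord_field_units [OF nonzero [OF g that]] by blast
  have 2: "\<theta> x h ^ n = 1" if "x \<in> carrier G" for x
    using dvd_h [OF that] ord_field_units [OF nonzero [OF that h]] by blast
  have gn: "g [^] n = \<one>"
    using g 1 by (intro nondegenerate) (auto simp: pow_left)
  have hn: "h [^] n = \<one>"
  proof (rule nondegenerate)
    fix y assume y: "y \<in> carrier G"
    have "\<theta> (h [^] n) y = inverse (\<theta> y h ^ n)"
      using h y by (simp add: pow_left skew' [of h y] power_inverse)
    then show "\<theta> (h [^] n) y = 1"
      using 2 [OF y] by simp
  qed (use h in auto)
  have "n \<noteq> 0"
    using ord_value_pos [OF g h] unfolding n_def by simp
  moreover have "n \<noteq> 1"
  proof
    assume "n = 1"
    have "x = \<one>" if x: "x \<in> carrier G" for x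
    proof (rule nondegenerate [OF x])
      fix y assume y: "y \<in> carrier G"
      have "?ord (\<theta> x y) = 1"
        using max [OF x y] ord_value_pos [OF x y] \<open>n = 1\<close> unfolding n_def by linarith
      then show "\<theta> x y = 1"
        using ord_field_units [OF nonzero [OF x y], of 1] by simp
    qed
    then show False
      using nontrivial by auto
  qed
  ultimately have "n > 1"
    by linarith
  show thesis
    using that [OF g h \<open>n > 1\<close> n_def [symmetric] gn hn 1 2] .
qed

end

lemma (in group) pow_mod_nat:
  assumes "x \<in> carrier G" "x [^] n = \<one>"
  shows "x [^] (k mod n) = x [^] (k::nat)"
proof -
  have "x [^] k = x [^] (n * (k div n) + k mod n)"
    by simp
  also have "\<dots> = (x [^] n) [^] (k div n) \<otimes> x [^] (k mod n)"
    using assms(1) by (simp only: nat_pow_mult nat_pow_pow)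
  finally show ?thesis
    using assms by simp
qed

lemma product_group_Suc_iso:
  "product_group {1..r} F \<times>\<times> F (Suc r) \<cong> product_group {1..Suc r} F"
proof (rule is_isoI, rule isoI)
  let ?f = "\<lambda>(x, y). x(Suc r := y)"
  have notin: "Suc r \<notin> {1..r}" and ins: "{1..Suc r} = insert (Suc r) {1..r}"
    by auto
  show "?f \<in> hom (product_group {1..r} F \<times>\<times> F (Suc r)) (product_group {1..Suc r} F)"
    by (rule homI) (auto simp: PiE_iff extensional_def fun_eq_iff Let_def split: if_splits)
  have "inj_on ?f (PiE {1..r} (\<lambda>i. carrier (F i)) \<times> carrier (F (Suc r)))"
  proof (rule inj_onI, clarify)
    fix x y x' y'
    assume x: "x \<in> PiE {1..r} (\<lambda>i. carrier (F i))" "x' \<in> PiE {1..r} (\<lambda>i. carrier (F i))"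
      and eq: "x(Suc r := y) = x'(Suc r := y')"
    have "x i = x' i" for i
    proof (cases "i = Suc r")
      case True
      then show ?thesis using x notin by (metis PiE_arb)
    next
      case False
      then show ?thesis using fun_cong [OF eq, of i] by simp
    qed
    then show "x = x' \<and> y = y'"
      using fun_cong [OF eq, of "Suc r"] by auto
  qed
  moreover have "?f ` (PiE {1..r} (\<lambda>i. carrier (F i)) \<times> carrier (F (Suc r)))
      = PiE {1..Suc r} (\<lambda>i. carrier (F i))"
    unfolding ins PiE_insert_eq by (auto simp: image_iff)
  ultimately show "bij_betw ?f (carrier (product_group {1..r} F \<times>\<times> F (Suc r)))
      (carrier (product_group {1..Suc r} F))"
    by (simp add: bij_betw_def)
qed

abbreviation hyperbolic_product :: "nat \<Rightarrow> (nat \<Rightarrow> nat) \<Rightarrow> (nat \<Rightarrow> int \<times> int) monoid" where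
  "hyperbolic_product r n \<equiv>
     product_group {1..r} (\<lambda>i. integer_mod_group (n i) \<times>\<times> integer_mod_group (n i))"

context alternating_bicharacter
begin

text \<open>
  The orthogonal complement \<open>Q\<close> of a pair \<open>g, h\<close> as above is a complement of
  \<open>\<langle>g\<rangle> \<times> \<langle>h\<rangle>\<close>: since all \<open>\<theta> x h\<close> and \<open>\<theta> g x\<close> are powers of \<open>\<theta> g h\<close>, dividing \<open>x\<close> by a suitable
  \<open>g ^ a * h ^ b\<close>, with unique \<open>a, b < n\<close>, gives an element of \<open>Q\<close>.
\<close>

lemma split_off_hyperbolic_pair:
  assumes nontrivial: "carrier G \<noteq> {\<one>}"
  obtains Q n where "subgroup Q G" "Q \<subset> carrier G" "n > 1"
    and "alternating_bicharacter (G\<lparr>carrier := Q\<rparr>) \<theta>"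
    and "G\<lparr>carrier := Q\<rparr> \<times>\<times> (integer_mod_group n \<times>\<times> integer_mod_group n) \<cong> G"
proof -
  obtain g h n where g: "g \<in> carrier G" and h: "h \<in> carrier G" and n: "n > 1"
    and ord: "group.ord field_units (\<theta> g h) = n"
    and gn: "g [^] n = \<one>" and hn: "h [^] n = \<one>"
    and gpow: "\<And>y. y \<in> carrier G \<Longrightarrow> \<theta> g y ^ n = 1"
    and hpow: "\<And>x. x \<in> carrier G \<Longrightarrow> \<theta> x h ^ n = 1"
    using hyperbolic_pair [OF nontrivial] by metis
  define \<zeta> where "\<zeta> = \<theta> g h"
  have \<zeta>0: "\<zeta> \<noteq> 0"
    using nonzero g h by (simp add: \<zeta>_def)
  have \<zeta>_inj: "a = b" if "\<zeta> ^ a = \<zeta> ^ b" "a < n" "b < n" for a b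
    using that
  proof (induction a b rule: linorder_wlog)
    case (le a b)
    then have "\<zeta> ^ (b - a) = 1"
      using \<zeta>0 by (simp add: power_diff)
    then have "n dvd b - a"
      using ord_field_units [OF \<zeta>0] ord by (simp add: \<zeta>_def)
    then show ?case
      using le by (metis diff_is_0_eq diff_less_mono2 dvd_imp_le le_antisym less_imp_diff_less not_le zero_less_diff)
  qed auto
  define Q where "Q = {x \<in> carrier G. \<theta> x h = 1 \<and> \<theta> g x = 1}"
  have Q: "subgroup Q G"
    by (rule subgroupI)
      (use g h in \<open>auto intro: exI [of _ \<one>] simp: Q_def mult_left mult_right inv_left inv_right\<close>)
  have "g \<notin> Q"
  proof
    assume "g \<in> Q"
    then have "\<zeta> = 1"
      by (simp add: Q_def \<zeta>_def)
    then have "n dvd 1"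
      using ord_field_units [OF \<zeta>0, of 1] ord unfolding \<zeta>_def by simp
    then show False
      using n by simp
  qed
  then have psub: "Q \<subset> carrier G"
    using g by (auto simp: Q_def)
  have dec: "\<exists>q\<in>Q. \<exists>a<n. \<exists>b<n. x = q \<otimes> (g [^] a \<otimes> h [^] b)" if x: "x \<in> carrier G" for x
  proof -
    obtain a where a: "a < n" "\<theta> x h = \<zeta> ^ a"
      using root_of_unity_is_power [OF \<zeta>0 ord [folded \<zeta>_def] _ hpow [OF x]] n by auto
    obtain b where b: "b < n" "\<theta> g x = \<zeta> ^ b"
      using root_of_unity_is_power [OF \<zeta>0 ord [folded \<zeta>_def] _ gpow [OF x]] n by auto
    define y where "y = g [^] a \<otimes> h [^] b"
    have y: "y \<in> carrier G"
      using g h by (simp add: y_def)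
    have "\<theta> y h = \<zeta> ^ a"
      using g h by (simp add: y_def mult_left pow_left alternating \<zeta>_def)
    moreover have "\<theta> g y = \<zeta> ^ b"
      using g h by (simp add: y_def mult_right pow_right alternating \<zeta>_def)
    ultimately have "x \<otimes> inv y \<in> Q"
      using x y g h a b \<zeta>0
      by (auto simp: Q_def mult_left mult_right inv_left inv_right)
    moreover have "x = (x \<otimes> inv y) \<otimes> y"
      using x y by (simp add: m_assoc)
    ultimately show ?thesis
      unfolding y_def using a b by metis
  qed
  have QG: "comm_group (G\<lparr>carrier := Q\<rparr>)"
    using psub by (intro group.group_comm_groupI [OF subgroup_imp_group [OF Q]]) (auto intro: m_comm)
  have bichar: "alternating_bicharacter (G\<lparr>carrier := Q\<rparr>) \<theta>"
  proof (intro alternating_bicharacter.intro alternating_bicharacter_axioms.intro QG)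
    fix x assume x: "x \<in> carrier (G\<lparr>carrier := Q\<rparr>)"
      and triv: "\<And>y. y \<in> carrier (G\<lparr>carrier := Q\<rparr>) \<Longrightarrow> \<theta> x y = 1"
    then have xG: "x \<in> carrier G" and xQ: "x \<in> Q"
      by (auto simp: Q_def)
    have "x = \<one>"
    proof (rule nondegenerate [OF xG])
      fix y assume "y \<in> carrier G"
      then obtain q a b where y: "q \<in> Q" "y = q \<otimes> (g [^] (a::nat) \<otimes> h [^] (b::nat))"
        using dec by blast
      have "\<theta> x q = 1" "\<theta> x h = 1" "\<theta> x g = 1"
        using triv [of q] y(1) xQ xG g skew' [of x g] by (simp_all add: Q_def)
      then show "\<theta> x y = 1"
        using y psub xG g h by (auto simp: mult_right pow_right)
    qed
    then show "x = \<one>\<^bsub>G\<lparr>carrier := Q\<rparr>\<^esub>" by simp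
  next
    show "Finite_Set.finite (carrier (G\<lparr>carrier := Q\<rparr>))"
      using psub finite by (simp add: finite_subset [of Q "carrier G"] psubset_imp_subset)
  qed (use psub in \<open>simp_all add: nonzero mult_left skew alternating psubset_eq subset_iff\<close>)
  let ?Z = "integer_mod_group n"
  have Z: "carrier ?Z = {0..<int n}"
    using n by (simp add: carrier_integer_mod_group)
  define \<phi> where "\<phi> = (\<lambda>(q, a, b). q \<otimes> (g [^] nat a \<otimes> h [^] nat b))"
  have nat_mod: "nat ((a + b) mod int n) = (nat a + nat b) mod n" if "0 \<le> a" "0 \<le> b" for a b
    using that by (simp add: nat_mod_distrib nat_add_distrib)
  have hom: "\<phi> \<in> hom (G\<lparr>carrier := Q\<rparr> \<times>\<times> (?Z \<times>\<times> ?Z)) G"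
  proof (rule homI)
    fix x y
    assume "x \<in> carrier (G\<lparr>carrier := Q\<rparr> \<times>\<times> (?Z \<times>\<times> ?Z))"
      "y \<in> carrier (G\<lparr>carrier := Q\<rparr> \<times>\<times> (?Z \<times>\<times> ?Z))"
    then obtain q a b q' a' b' where x: "x = (q, a, b)" and y: "y = (q', a', b')"
      and "q \<in> Q" "q' \<in> Q" and ab: "0 \<le> a" "0 \<le> b" "0 \<le> a'" "0 \<le> b'"
      by (auto simp: Z)
    then have q: "q \<in> carrier G" "q' \<in> carrier G"
      using psub by auto
    have pow: "u [^] nat ((c + c') mod int n) = u [^] nat c \<otimes> u [^] nat c'"
      if "u \<in> carrier G" "u [^] n = \<one>" "0 \<le> c" "0 \<le> c'" for u and c c' :: int
      using that by (simp only: nat_mod pow_mod_nat nat_pow_mult)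
    show "\<phi> (x \<otimes>\<^bsub>G\<lparr>carrier := Q\<rparr> \<times>\<times> (?Z \<times>\<times> ?Z)\<^esub> y) = \<phi> x \<otimes> \<phi> y"
      using q g h ab by (simp add: x y \<phi>_def pow gn hn m_ac del: pow_nat)
  qed (use g h psub in \<open>auto simp: \<phi>_def\<close>)
  moreover have "bij_betw \<phi> (carrier (G\<lparr>carrier := Q\<rparr> \<times>\<times> (?Z \<times>\<times> ?Z))) (carrier G)"
  proof (rule bij_betwI')
    fix x y
    assume "x \<in> carrier (G\<lparr>carrier := Q\<rparr> \<times>\<times> (?Z \<times>\<times> ?Z))"
      "y \<in> carrier (G\<lparr>carrier := Q\<rparr> \<times>\<times> (?Z \<times>\<times> ?Z))"
    then obtain q a b q' a' b' where x: "x = (q, a, b)" and y: "y = (q', a', b')"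
      and q: "q \<in> Q" "q' \<in> Q" and ab: "0 \<le> a" "0 \<le> b" "0 \<le> a'" "0 \<le> b'"
      and abn: "a < int n" "b < int n" "a' < int n" "b' < int n"
      by (auto simp: Z)
    have \<theta>h: "\<theta> (\<phi> (q, a, b)) h = \<zeta> ^ nat a" if "q \<in> Q" for q a b
      using that g h by (simp add: \<phi>_def Q_def mult_left pow_left alternating \<zeta>_def)
    have \<theta>g: "\<theta> g (\<phi> (q, a, b)) = \<zeta> ^ nat b" if "q \<in> Q" for q a b
      using that g h by (simp add: \<phi>_def Q_def mult_right pow_right alternating \<zeta>_def)
    show "\<phi> x = \<phi> y \<longleftrightarrow> x = y"
    proof
      assume eq: "\<phi> x = \<phi> y"
      have "\<zeta> ^ nat a = \<zeta> ^ nat a'" "\<zeta> ^ nat b = \<zeta> ^ nat b'"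
        using \<theta>h [OF q(1), of a b] \<theta>h [OF q(2), of a' b'] \<theta>g [OF q(1), of a b] \<theta>g [OF q(2), of a' b'] eq
        unfolding x y by simp_all
      then have "nat a = nat a'" "nat b = nat b'"
        using \<zeta>_inj [of "nat a" "nat a'"] \<zeta>_inj [of "nat b" "nat b'"] ab abn by auto
      then have "a = a'" "b = b'"
        using ab by auto
      then show "x = y"
        using eq subsetD [OF psubset_imp_subset [OF psub]] q g h unfolding x y \<phi>_def by simp
    qed simp
  next
    fix x assume "x \<in> carrier G"
    then obtain q a b where "q \<in> Q" "a < n" "b < n" "x = q \<otimes> (g [^] a \<otimes> h [^] b)"
      using dec by blast
    then show "\<exists>z\<in>carrier (G\<lparr>carrier := Q\<rparr> \<times>\<times> (?Z \<times>\<times> ?Z)). x = \<phi> z"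
      by (intro bexI [of _ "(q, int a, int b)"]) (auto simp: \<phi>_def Z)
  qed (use hom in \<open>auto simp: hom_def\<close>)
  ultimately have "G\<lparr>carrier := Q\<rparr> \<times>\<times> (?Z \<times>\<times> ?Z) \<cong> G"
    by (intro is_isoI isoI)
  then show thesis
    using that Q psub n bichar by blast
qed

end

text \<open>Split off hyperbolic pairs until the group is trivial.\<close>

theorem alternating_bicharacter_imp_iso_hyperbolic:
  assumes "alternating_bicharacter G \<theta>"
  shows "\<exists>r n. (\<forall>i\<in>{1..r}. 0 < n i) \<and> G \<cong> hyperbolic_product r n"
  using assms
proof (induction "card (carrier G)" arbitrary: G rule: less_induct)
  case less
  interpret alternating_bicharacter G \<theta> by fact
  show ?case
  proof (cases "carrier G = {\<one>\<^bsub>G\<^esub>}")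
    case True
    have "(\<lambda>x. \<lambda>_. undefined) \<in> iso G (hyperbolic_product 0 n)" for n
      using True by (auto simp: iso_def hom_def bij_betw_def)
    then show ?thesis
      by (intro exI [of _ 0] exI [of _ "\<lambda>_. 0"] conjI is_isoI) auto
  next
    case False
    then obtain Q k where Q: "subgroup Q G" "Q \<subset> carrier G" and k: "k > 1"
      and bichar: "alternating_bicharacter (G\<lparr>carrier := Q\<rparr>) \<theta>"
      and iso: "G\<lparr>carrier := Q\<rparr> \<times>\<times> (integer_mod_group k \<times>\<times> integer_mod_group k) \<cong> G"
      using split_off_hyperbolic_pair by metis
    have "card (carrier (G\<lparr>carrier := Q\<rparr>)) < card (carrier G)"
      using Q finite by (simp add: psubset_card_mono)
    then obtain r n where n: "\<forall>i\<in>{1..r}. 0 < n i"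
      and isoQ: "G\<lparr>carrier := Q\<rparr> \<cong> hyperbolic_product r n"
      using less.hyps bichar by blast
    define n' where "n' = n(Suc r := k)"
    have same: "hyperbolic_product r n = hyperbolic_product r n'"
      unfolding product_group_def n'_def by (auto intro!: PiE_cong simp: fun_eq_iff)
    let ?Z = "integer_mod_group k \<times>\<times> integer_mod_group k"
    interpret QG: group "G\<lparr>carrier := Q\<rparr>"
      by (rule subgroup_imp_group [OF Q(1)])
    have grp: "group (G\<lparr>carrier := Q\<rparr> \<times>\<times> ?Z)" "group (hyperbolic_product r n \<times>\<times> ?Z)"
      by (intro DirProd_group QG.is_group product_group group_integer_mod_group)+
    have "G \<cong> G\<lparr>carrier := Q\<rparr> \<times>\<times> ?Z"
      using group.iso_sym [OF grp(1) iso] .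
    also have "\<dots> \<cong> hyperbolic_product r n \<times>\<times> ?Z"
      using QG.DirProd_iso_trans [OF isoQ iso_refl] .
    also have "\<dots> \<cong> hyperbolic_product (Suc r) n'"
      using product_group_Suc_iso [of r "\<lambda>i. integer_mod_group (n' i) \<times>\<times> integer_mod_group (n' i)"]
      unfolding same by (simp add: n'_def)
    finally have "G \<cong> hyperbolic_product (Suc r) n'" .
    moreover have "\<forall>i\<in>{1..Suc r}. 0 < n' i"
      using n k by (auto simp: n'_def)
    ultimately show ?thesis
      by blast
  qed
qed

lemma card_hyperbolic_product:
  assumes "\<forall>i\<in>{1..r}. 0 < n i"
  shows "card (carrier (hyperbolic_product r n)) = (\<Prod>i\<in>{1..r}. n i) ^ 2"
proof -
  have "card (carrier (hyperbolic_product r n)) = (\<Prod>i\<in>{1..r}. n i * n i)"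
    using assms by (auto simp: card_PiE card_cartesian_product carrier_integer_mod_group intro!: prod.cong)
  then show ?thesis
    by (simp add: prod.distrib power2_eq_square)
qed

section \<open>Central idempotents of semisimple algebras\<close>

context unital_algebra
begin

definition central_idempotent :: "'a \<Rightarrow> bool" where
  "central_idempotent e \<longleftrightarrow> e * e = e \<and> (\<forall>x. e * x = x * e)"

text \<open>For a central idempotent \<open>e\<close> of the algebra \<open>A\<close> this is the corner ring \<open>e A e = e A\<close>.\<close>

definition corner :: "'a \<Rightarrow> 'a set" where
  "corner e = range ((*) e)"

lemma central_idempotentD:
  assumes "central_idempotent e"
  shows "e * e = e" "e * x = x * e"
  using assms unfolding central_idempotent_def by blast+

lemma corner_iff: "central_idempotent e \<Longrightarrow> x \<in> corner e \<longleftrightarrow> e * x = x"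
proof
  assume e: "central_idempotent e" and "x \<in> corner e"
  then obtain y where "x = e * y"
    by (auto simp: corner_def)
  then show "e * x = x"
    by (simp add: mult.assoc [symmetric] central_idempotentD(1) [OF e])
next
  assume "e * x = x"
  then show "x \<in> corner e"
    unfolding corner_def by (metis rangeI)
qed

lemma corner_self: "central_idempotent e \<Longrightarrow> e \<in> corner e"
  by (simp add: corner_iff central_idempotentD)

lemma corner_0 [simp]: "corner 0 = {0}"
  by (auto simp: corner_def)

lemma subspace_corner: "subspace (corner e)"
proof (rule subspaceI)
  show "0 \<in> corner e"
    using rangeI [of "(*) e" 0] by (simp add: corner_def)
next
  fix x y c
  assume "x \<in> corner e"
  then obtain a where a: "x = e * a"
    by (auto simp: corner_def)
  show "c *s x \<in> corner e"
    using rangeI [of "(*) e" "c *s a"] by (simp add: corner_def a scale_mult_right)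
  assume "y \<in> corner e"
  then obtain b where b: "y = e * b"
    by (auto simp: corner_def)
  show "x + y \<in> corner e"
    using rangeI [of "(*) e" "a + b"] by (simp add: corner_def a b distrib_left)
qed

lemma ideal_of_corner:
  assumes e: "central_idempotent e"
  shows "ideal_of UNIV (corner e)"
  unfolding ideal_of_def
proof (intro conjI ballI subspace_corner)
  fix b x assume "x \<in> corner e"
  then have x: "e * x = x"
    using e by (simp add: corner_iff)
  have "e * (b * x) = b * (e * x)"
    by (simp only: mult.assoc [symmetric] central_idempotentD(2) [OF e, of b])
  then show "b * x \<in> corner e"
    using x e by (simp add: corner_iff)
  show "x * b \<in> corner e"
    using x e by (simp add: corner_iff flip: mult.assoc)
qed simp

lemma ideal_of_corner_imp_ideal:
  assumes e: "central_idempotent e" and I: "ideal_of (corner e) I"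
  shows "ideal_of UNIV I"
proof -
  have "b * x \<in> I \<and> x * b \<in> I" if x: "x \<in> I" for b x
  proof -
    have "x \<in> corner e"
      using I x unfolding ideal_of_def by blast
    then have ex: "e * x = x" "x * e = x"
      using central_idempotentD(2) [OF e, of x] by (simp_all add: corner_iff [OF e])
    have eb: "e * b \<in> corner e"
      by (simp add: corner_def)
    have "b * x = b * (e * x)"
      by (simp only: ex(1))
    also have "\<dots> = (e * b) * x"
      by (simp only: mult.assoc [symmetric] central_idempotentD(2) [OF e, of b])
    finally have "b * x = (e * b) * x" .
    moreover have "x * b = x * (e * b)"
      by (simp only: mult.assoc [symmetric] ex)
    ultimately show ?thesis
      using I x eb unfolding ideal_of_def by metis
  qed
  then show ?thesis
    using I unfolding ideal_of_def by blast
qed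

lemma central_idempotent_diff:
  assumes e: "central_idempotent e" and f: "central_idempotent f" and "e * f = f"
  shows "central_idempotent (e - f)"
  unfolding central_idempotent_def
proof (intro conjI allI)
  have "f * e = f"
    using \<open>e * f = f\<close> central_idempotentD(2) [OF e, of f] by simp
  then show "(e - f) * (e - f) = e - f"
    using \<open>e * f = f\<close>
    by (simp add: left_diff_distrib right_diff_distrib central_idempotentD(1) [OF e]
      central_idempotentD(1) [OF f])
  show "(e - f) * x = x * (e - f)" for x
    by (simp add: left_diff_distrib right_diff_distrib central_idempotentD(2) [OF e, of x]
      central_idempotentD(2) [OF f, of x])
qed

text \<open>The projections of the decomposition are the multiplications by the idempotents.\<close>

lemma direct_sum_decomposition_corner:
  assumes S: "finite S" and idem: "\<And>s. s \<in> S \<Longrightarrow> central_idempotent (e s)"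
    and orth: "\<And>s t. \<lbrakk>s \<in> S; t \<in> S; s \<noteq> t\<rbrakk> \<Longrightarrow> e s * e t = 0"
    and sum: "(\<Sum>s\<in>S. e s) = 1"
  shows "direct_sum_decomposition S (\<lambda>s. corner (e s))"
  unfolding direct_sum_decomposition_def
proof (intro conjI ballI allI)
  fix x
  show "\<exists>!f. f \<in> (\<Pi>\<^sub>E s\<in>S. corner (e s)) \<and> x = (\<Sum>s\<in>S. f s)"
  proof (rule ex1I [of _ "\<lambda>s\<in>S. e s * x"])
    show "(\<lambda>s\<in>S. e s * x) \<in> (\<Pi>\<^sub>E s\<in>S. corner (e s)) \<and> x = (\<Sum>s\<in>S. (\<lambda>s\<in>S. e s * x) s)"
      using sum by (auto simp: corner_def simp flip: sum_distrib_right)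
  next
    fix f assume f: "f \<in> (\<Pi>\<^sub>E s\<in>S. corner (e s)) \<and> x = (\<Sum>s\<in>S. f s)"
    have "f s = e s * x" if s: "s \<in> S" for s
    proof -
      have "e s * f t = (if t = s then f s else 0)" if t: "t \<in> S" for t
      proof (cases "t = s")
        case True
        then show ?thesis using f s corner_iff [OF idem [OF s]] by (auto simp: PiE_iff)
      next
        case False
        have "f t = e t * f t"
          using f t corner_iff [OF idem [OF t]] by (auto simp: PiE_iff)
        then have "e s * f t = e s * (e t * f t)"
          by (rule arg_cong)
        also have "\<dots> = 0"
          using orth s t False by (simp flip: mult.assoc)
        finally show ?thesis using False by simp
      qed
      then show ?thesis
        using f s S by (simp add: sum_distrib_left cong: sum.cong)
    qed
    then show "f = (\<lambda>s\<in>S. e s * x)"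
      using f by (auto simp: PiE_iff extensional_def fun_eq_iff)
  qed
qed (simp_all add: S subspace_corner)

lemma sum_orthogonal_mult:
  fixes e :: 'a
  assumes "finite E" "e \<in> E" "\<And>f. f \<in> E \<Longrightarrow> f \<noteq> e \<Longrightarrow> e * f = 0" "e * e = e"
  shows "e * \<Sum>E = e"
proof -
  have "e * \<Sum>E = (\<Sum>f\<in>E. if f = e then e else 0)"
    unfolding sum_distrib_left by (rule sum.cong) (use assms in auto)
  then show ?thesis
    using assms by simp
qed

end

locale semisimple_algebra =
  unital_algebra scale + finite_dimensional_vector_space scale Basis
  for scale :: "'k::field \<Rightarrow> 'a::ring_1 \<Rightarrow> 'a" (infixr \<open>*s\<close> 75) and Basis :: "'a set" +
  assumes semisimple: semisimple
begin

lemma left_ideal_right_identity: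
  assumes L: "left_ideal L"
  obtains e where "e \<in> L" "\<And>x. x \<in> L \<Longrightarrow> x * e = x"
proof -
  obtain L' where L': "left_ideal L'" and int: "L \<inter> L' = {0}"
    and sum: "\<forall>x. \<exists>y\<in>L. \<exists>z\<in>L'. x = y + z"
    using semisimple [unfolded semisimple_def, rule_format, OF L] by (elim exE conjE)
  obtain e e' where e: "e \<in> L" and e': "e' \<in> L'" and one: "1 = e + e'"
    using spec [OF sum, of 1] by blast
  have "x * e = x" if x: "x \<in> L" for x
  proof -
    have "x * e' = x - x * e"
      using one by (metis add_diff_cancel_left' distrib_left mult.right_neutral)
    also have "\<dots> \<in> L"
      using x e L unfolding left_ideal_def by (auto intro: subspace_diff)
    finally have "x * e' \<in> L" .
    moreover have "x * e' \<in> L'"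
      using e' L' unfolding left_ideal_def by auto
    ultimately have "x * e' = 0"
      using int by auto
    then show ?thesis
      using one by (metis add.right_neutral distrib_left mult.right_neutral)
  qed
  then show thesis
    using that e by blast
qed

text \<open>
  A right identity \<open>e\<close> of \<open>I\<close> exists by semisimplicity. It is also a left identity because the
  elements \<open>x - e x\<close> lie in the left ideal \<open>{x \<in> I. I x = 0}\<close>, which vanishes as it has a right identity
  of its own. A two-sided identity of an ideal is central.
\<close>

lemma ideal_eq_corner:
  assumes I: "ideal_of UNIV I"
  obtains e where "central_idempotent e" "I = corner e"
proof -
  have sub: "subspace I" and left: "\<And>b x. x \<in> I \<Longrightarrow> b * x \<in> I"
    and right: "\<And>b x. x \<in> I \<Longrightarrow> x * b \<in> I"
    using I by (auto simp: ideal_of_def)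
  have "left_ideal I"
    by (simp add: left_ideal_def sub left)
  then obtain e where e: "e \<in> I" and xe: "\<And>x. x \<in> I \<Longrightarrow> x * e = x"
    using left_ideal_right_identity by blast
  define N where "N = {x \<in> I. \<forall>y\<in>I. y * x = 0}"
  have "subspace N"
    using sub unfolding N_def
    by (auto intro!: subspaceI simp: subspace_0 subspace_add subspace_scale distrib_left scale_mult_right)
  then have "left_ideal N"
    unfolding left_ideal_def using left right by (auto simp: N_def simp flip: mult.assoc)
  then obtain d where d: "d \<in> N" and xd: "\<And>x. x \<in> N \<Longrightarrow> x * d = x"
    using left_ideal_right_identity by blast
  have N0: "x = 0" if "x \<in> N" for x
    using xd [OF that] d that by (auto simp: N_def)
  have ex: "e * x = x" if x: "x \<in> I" for x
  proof -
    have "x - e * x \<in> I"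
      using x sub left by (simp add: subspace_diff)
    moreover have "y * (x - e * x) = 0" if "y \<in> I" for y
      using xe [OF that] by (simp add: right_diff_distrib flip: mult.assoc)
    ultimately have "x - e * x \<in> N"
      by (simp add: N_def)
    then show ?thesis
      using N0 by force
  qed
  have "e * x = x * e" for x
  proof -
    have "e * x = (e * x) * e"
      using xe [OF right [OF e]] by (rule sym)
    also have "\<dots> = x * e"
      unfolding mult.assoc by (rule ex [OF left [OF e]])
    finally show ?thesis .
  qed
  then have "central_idempotent e"
    unfolding central_idempotent_def using ex [OF e] by blast
  moreover have "I = corner e"
  proof
    show "I \<subseteq> corner e"
      unfolding corner_def by (metis ex rangeI subsetI)
    show "corner e \<subseteq> I"
      unfolding corner_def using right [OF e] by blast
  qed
  ultimately show thesis
    using that by blast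
qed

lemma square_zero_ideal:
  assumes "ideal_of UNIV N" "\<And>x y. \<lbrakk>x \<in> N; y \<in> N\<rbrakk> \<Longrightarrow> x * y = 0"
  shows "N = {0}"
proof -
  obtain e where e: "central_idempotent e" "N = corner e"
    using ideal_eq_corner assms(1) by blast
  then have "e * e = 0"
    using assms(2) corner_self by blast
  then show ?thesis
    using e central_idempotentD(1) [OF e(1)] by simp
qed

lemma dim_corner_less:
  assumes e: "central_idempotent e" and f: "central_idempotent f" and "e * f = f" "f \<noteq> e"
  shows "dim (corner f) < dim (corner e)"
proof -
  have "corner f \<subseteq> corner e"
    using e f \<open>e * f = f\<close>
    by (clarsimp simp: corner_iff) (metis mult.assoc)
  moreover have "e \<notin> corner f"
    using assms by (auto simp: corner_iff central_idempotentD(2) [OF f])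
  moreover have "e \<in> corner e"
    using e by (rule corner_self)
  ultimately have "span (corner f) \<subset> span (corner e)"
    by (metis psubsetI span_eq_iff subspace_corner)
  then show ?thesis
    by (rule dim_psubset)
qed

text \<open>
  A proper nonzero ideal of \<open>corner e\<close> is generated by a central idempotent \<open>f\<close>, which splits
  \<open>e\<close> into the orthogonal idempotents \<open>f\<close> and \<open>e - f\<close> with corners of smaller dimension.
\<close>

lemma central_idempotent_sum_of_simple:
  assumes "central_idempotent e"
  shows "\<exists>E. finite E \<and> (\<forall>f\<in>E. central_idempotent f \<and> simple_ideal (corner f)) \<and>
    (\<forall>f\<in>E. \<forall>g\<in>E. f \<noteq> g \<longrightarrow> f * g = 0) \<and> \<Sum>E = e"
  using assms
proof (induction "dim (corner e)" arbitrary: e rule: less_induct)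
  case less
  note e = less.prems
  consider "e = 0" | "simple_ideal (corner e)"
    | I where "e \<noteq> 0" "ideal_of (corner e) I" "I \<noteq> {0}" "I \<noteq> corner e"
    using ideal_of_corner [OF e] corner_self [OF e] unfolding simple_ideal_def by auto
  then show ?case
  proof cases
    case 1
    then show ?thesis by (intro exI [of _ "{}"]) auto
  next
    case 2
    then show ?thesis using e by (intro exI [of _ "{e}"]) auto
  next
    case 3
    obtain f where f: "central_idempotent f" and I: "I = corner f"
      using ideal_eq_corner ideal_of_corner_imp_ideal [OF e 3(2)] by blast
    have "f \<in> corner e"
      using 3(2) corner_self [OF f] I by (auto simp: ideal_of_def)
    then have ef: "e * f = f"
      using e by (simp add: corner_iff)
    have ne: "f \<noteq> e" "f \<noteq> 0"
      using 3 I by auto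
    have d: "central_idempotent (e - f)"
      using central_idempotent_diff [OF e f ef] .
    have ed: "e * (e - f) = e - f" "e - f \<noteq> e"
      using ef ne by (auto simp: right_diff_distrib central_idempotentD(1) [OF e])
    obtain E where E: "finite E" "\<forall>f\<in>E. central_idempotent f \<and> simple_ideal (corner f)"
      "\<forall>f\<in>E. \<forall>g\<in>E. f \<noteq> g \<longrightarrow> f * g = 0" and sumE: "\<Sum>E = f"
      using less.hyps [OF dim_corner_less [OF e f ef ne(1)] f] by (elim exE conjE)
    obtain D where D: "finite D" "\<forall>f\<in>D. central_idempotent f \<and> simple_ideal (corner f)"
      "\<forall>f\<in>D. \<forall>g\<in>D. f \<noteq> g \<longrightarrow> f * g = 0" and sumD: "\<Sum>D = e - f"
      using less.hyps [OF dim_corner_less [OF e d ed] d] by (elim exE conjE)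
    have fd: "f * (e - f) = 0"
      using ef central_idempotentD(1) [OF f] central_idempotentD(2) [OF f, of e]
      by (simp add: right_diff_distrib)
    have cross: "x * y = 0 \<and> y * x = 0" if x: "x \<in> E" and y: "y \<in> D" for x y
    proof -
      have cx: "central_idempotent x" and cy: "central_idempotent y"
        using E(2) D(2) x y by blast+
      have "x * f = x"
        using sum_orthogonal_mult [of E x] E(1,3) x sumE central_idempotentD(1) [OF cx] by metis
      moreover have "y * (e - f) = y"
        using sum_orthogonal_mult [of D y] D(1,3) y sumD central_idempotentD(1) [OF cy] by metis
      ultimately have "x * y = (x * f) * ((e - f) * y)"
        using central_idempotentD(2) [OF d, of y] by simp
      also have "\<dots> = x * (f * (e - f)) * y"
        by (simp only: mult.assoc)
      finally have "x * y = x * (f * (e - f)) * y" .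
      then have "x * y = 0"
        using fd by simp
      then show ?thesis
        using central_idempotentD(2) [OF cx, of y] by simp
    qed
    have "E \<inter> D = {}"
    proof (rule ccontr)
      assume "E \<inter> D \<noteq> {}"
      then obtain x where x: "x \<in> E" "x \<in> D"
        by auto
      then have "x = 0"
        using cross [OF x] central_idempotentD(1) [of x] E(2) by metis
      then show False
        using E(2) x by (auto simp: simple_ideal_def)
    qed
    then have "\<Sum>(E \<union> D) = e"
      using E(1) D(1) sumE sumD by (simp add: sum.union_disjoint)
    then show ?thesis
      using E D cross by (intro exI [of _ "E \<union> D"]) blast
  qed
qed

lemma simple_component_corner:
  assumes e: "central_idempotent e" and simple: "simple_ideal (corner e)"
  shows "simple_component (corner e)"
proof -
  have one: "central_idempotent 1"
    unfolding central_idempotent_def by simp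
  have d: "central_idempotent (1 - e)"
    using central_idempotent_diff [OF one e] by (simp only: mult_1_left)
  obtain D where D: "finite D" "\<And>f. f \<in> D \<Longrightarrow> central_idempotent f"
    "\<And>f. f \<in> D \<Longrightarrow> simple_ideal (corner f)"
    "\<And>f g. \<lbrakk>f \<in> D; g \<in> D; f \<noteq> g\<rbrakk> \<Longrightarrow> f * g = 0" and sumD: "\<Sum>D = 1 - e"
    using central_idempotent_sum_of_simple [OF d] by metis
  have ed: "e * f = 0 \<and> f * e = 0" if f: "f \<in> D" for f
  proof -
    have "f * (1 - e) = f"
      using sum_orthogonal_mult [of D f] D(1,4) f sumD central_idempotentD(1) [OF D(2) [OF f]]
      by metis
    then have "f * e = 0"
      by (simp add: right_diff_distrib)
    then show ?thesis
      using central_idempotentD(2) [OF e, of f] by simp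
  qed
  have "e \<notin> D"
  proof
    assume "e \<in> D"
    then have "e = 0"
      using ed [of e] central_idempotentD(1) [OF e] by simp
    then show False
      using simple by (simp add: simple_ideal_def)
  qed
  then have sum: "\<Sum>(insert e D) = 1"
    using D(1) sumD by simp
  obtain h where h: "bij_betw h {1..card (insert e D)} (insert e D)"
    using ex_bij_betw_nat_finite_1 [of "insert e D"] D(1) by auto
  have hD: "h l \<in> insert e D" if "l \<in> {1..card (insert e D)}" for l
    using h that bij_betwE by blast
  have "direct_sum_decomposition {1..card (insert e D)} (\<lambda>l. corner (h l))"
  proof (rule direct_sum_decomposition_corner)
    show "central_idempotent (h l)" if "l \<in> {1..card (insert e D)}" for l
      using hD [OF that] e D(2) by auto
    show "h k * h l = 0" if "k \<in> {1..card (insert e D)}" "l \<in> {1..card (insert e D)}" "k \<noteq> l" for k l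
    proof -
      have "h k \<noteq> h l"
        using h that by (metis bij_betw_imp_inj_on inj_on_contraD)
      then show ?thesis
        using hD that D(4) ed by (metis insert_iff)
    qed
    show "(\<Sum>l\<in>{1..card (insert e D)}. h l) = 1"
      using sum sum.reindex_bij_betw [OF h, of "\<lambda>x. x"] by simp
  qed simp
  moreover have "simple_ideal (corner (h l))" if "l \<in> {1..card (insert e D)}" for l
    using hD [OF that] simple D(3) by auto
  moreover obtain l where "l \<in> {1..card (insert e D)}" "h l = e"
    using h by (metis bij_betw_imp_surj_on imageE insertI1)
  ultimately show ?thesis
    unfolding simple_component_def by blast
qed

end

section \<open>Eigenvectors in finite-dimensional algebras\<close>

locale finite_dimensional_algebra =
  unital_algebra scale + finite_dimensional_vector_space scale Basis
  for scale :: "'k::alg_closed_field \<Rightarrow> 'a::ring_1 \<Rightarrow> 'a" (infixr \<open>*s\<close> 75) and Basis :: "'a set"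
begin

text \<open>
  The coefficients are scalars and the argument lies in the algebra, which may be noncommutative.
\<close>

definition poly_eval :: "'a \<Rightarrow> 'k poly \<Rightarrow> 'a" where
  "poly_eval x p = (\<Sum>i\<le>Polynomial.degree p. Polynomial.coeff p i *s x ^ i)"

lemma poly_eval_altdef:
  assumes "Polynomial.degree p \<le> n"
  shows "poly_eval x p = (\<Sum>i\<le>n. Polynomial.coeff p i *s x ^ i)"
  unfolding poly_eval_def using assms by (intro sum.mono_neutral_left) (auto simp: coeff_eq_0)

lemma poly_eval_linear_factor: "poly_eval x ([:- c, 1:] * q) = (x - c *s 1) * poly_eval x q"
proof -
  define n where "n = Polynomial.degree q"
  have "Polynomial.degree ([:- c, 1:] * q) \<le> Suc n"
    using degree_mult_le [of "[:- c, 1:]" q] by (simp add: n_def)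
  then have "poly_eval x ([:- c, 1:] * q) =
      (\<Sum>i\<le>Suc n. Polynomial.coeff ([:- c, 1:] * q) i *s x ^ i)"
    by (rule poly_eval_altdef)
  also have "\<dots> = (\<Sum>i\<le>Suc n. Polynomial.coeff (pCons 0 q) i *s x ^ i)
      - (\<Sum>i\<le>Suc n. (c * Polynomial.coeff q i) *s x ^ i)"
    by (simp add: sum_subtractf scale_left_diff_distrib del: sum.atMost_Suc)
  also have "(\<Sum>i\<le>Suc n. Polynomial.coeff (pCons 0 q) i *s x ^ i) = x * poly_eval x q"
    unfolding sum.atMost_Suc_shift
    by (simp add: poly_eval_def n_def sum_distrib_left scale_mult_right)
  also have "(\<Sum>i\<le>Suc n. (c * Polynomial.coeff q i) *s x ^ i) = c *s poly_eval x q"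
    by (simp add: poly_eval_altdef [of q "Suc n"] n_def scale_sum_right scale_right_distrib)
  finally show ?thesis
    by (simp add: left_diff_distrib scale_mult_left)
qed

text \<open>The vectors \<open>x ^ i * v\<close> for \<open>i \<le> dim A\<close> are linearly dependent.\<close>

lemma annihilating_poly:
  obtains p where "p \<noteq> 0" "poly_eval x p * v = 0"
proof -
  define n where "n = dim UNIV"
  define f where "f i = x ^ i * v" for i :: nat
  have eval: "poly_eval x p * v = (\<Sum>i\<le>n. Polynomial.coeff p i *s f i)"
    if "Polynomial.degree p \<le> n" for p
    using that by (simp add: poly_eval_altdef sum_distrib_right scale_mult_left f_def)
  have "\<exists>u. (\<exists>i\<le>n. u i \<noteq> 0) \<and> (\<Sum>i\<le>n. u i *s f i) = 0"
    (* dependence is a property of sets of vectors, which do not see repetitions in the family f *)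
  proof (cases "inj_on f {..n}")
    case True
    have "card (f ` {..n}) > n"
      using True by (simp add: card_image)
    then have "dependent (f ` {..n})"
      using independent_card_le_dim [of "f ` {..n}" UNIV] unfolding n_def by force
    then obtain u where "\<exists>y\<in>f ` {..n}. u y \<noteq> 0" "(\<Sum>y\<in>f ` {..n}. u y *s y) = 0"
      using dependent_finite [of "f ` {..n}"] by auto
    then show ?thesis
      using True by (intro exI [of _ "u \<circ> f"]) (auto simp: sum.reindex)
  next
    case False
    then obtain i j where ij: "i \<le> n" "j \<le> n" "i \<noteq> j" "f i = f j"
      by (auto simp: inj_on_def)
    have "(\<Sum>k\<le>n. (if k = i then 1 else if k = j then - 1 else 0) *s f k) =
        (\<Sum>k\<le>n. (if k = i then f i else 0) - (if k = j then f j else 0))"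
      using ij by (intro sum.cong) auto
    also have "\<dots> = 0"
      using ij by (simp add: sum_subtractf)
    finally show ?thesis
      using ij by (intro exI [of _ "\<lambda>k. if k = i then 1 else if k = j then - 1 else 0"]) auto
  qed
  then obtain u i where i: "i \<le> n" "u i \<noteq> 0" and u: "(\<Sum>i\<le>n. u i *s f i) = 0"
    by blast
  define p where "p = (\<Sum>i\<le>n. Polynomial.monom (u i) i)"
  have coeff: "Polynomial.coeff p k = (if k \<le> n then u k else 0)" for k
    by (simp add: p_def coeff_sum)
  have "Polynomial.degree p \<le> n"
    by (rule degree_le) (simp add: coeff)
  then have "poly_eval x p * v = 0"
    using u by (simp add: eval coeff)
  moreover have "p \<noteq> 0"
    using i coeff [of i] by auto
  ultimately show thesis
    using that by blast
qed

text \<open>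
  Splitting linear factors \<open>X - c\<close> off a polynomial that annihilates \<open>v\<close>, there is a last nonzero
  vector, and the next factor turns it into zero. It has the form \<open>q * v\<close>, so it lies in
  every left ideal that contains \<open>v\<close>.
\<close>

lemma left_mult_eigenvector:
  assumes "v \<noteq> 0"
  obtains c q where "q * v \<noteq> 0" "x * (q * v) = c *s (q * v)"
proof -
  have "\<exists>c q. q * v \<noteq> 0 \<and> x * (q * v) = c *s (q * v)" if "p \<noteq> 0" "poly_eval x p * v = 0" for p
    using that
  proof (induction "Polynomial.degree p" arbitrary: p rule: less_induct)
    case less
    have "Polynomial.degree p > 0"
    proof (rule ccontr)
      assume "\<not> Polynomial.degree p > 0"
      then obtain a where "p = [:a:]" "a \<noteq> 0"
        using less.prems by (metis degree_eq_zeroE gr0I pCons_0_0)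
      then show False
        using less.prems \<open>v \<noteq> 0\<close> by (simp add: poly_eval_def scale_mult_left)
    qed
    then obtain c where "poly p c = 0"
      using alg_closed_imp_poly_has_root by blast
    then obtain q where p: "p = [:- c, 1:] * q"
      by (auto simp: poly_eq_0_iff_dvd)
    then have q: "q \<noteq> 0"
      using less.prems by auto
    show ?case
    proof (cases "poly_eval x q * v = 0")
      case True
      have "Polynomial.degree q < Polynomial.degree p"
        using q unfolding p by (subst degree_mult_eq) auto
      then show ?thesis
        using less.hyps [OF _ q True] by blast
    next
      case False
      have "(x - c *s 1) * (poly_eval x q * v) = 0"
        using less.prems(2) unfolding p poly_eval_linear_factor by (simp add: mult.assoc)
      then have "x * (poly_eval x q * v) = c *s (poly_eval x q * v)"
        by (simp add: left_diff_distrib scale_mult_left)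
      with False show ?thesis
        by blast
    qed
  qed
  then show thesis
    using annihilating_poly that by metis
qed

end

section \<open>Quantum commutative gradings\<close>

locale quantum_commutative_grading =
  unital_algebra scale
  for scale :: "'k::field \<Rightarrow> 'a::ring_1 \<Rightarrow> 'a" (infixr \<open>*s\<close> 75) +
  fixes S :: "'i set" and R :: "'i \<Rightarrow> 'a set" and \<theta> :: "'i \<Rightarrow> 'i \<Rightarrow> 'k"
  assumes grading: "set_grading S R"
    and regular: "regular_quantum_commutative S R \<theta>"
    and minimal: "minimal_matrix S \<theta>"
begin

lemma decomposition: "direct_sum_decomposition S R"
  using grading by (simp add: set_grading_def)

lemma finite_S [simp]: "finite S"
  using decomposition by (simp add: direct_sum_decomposition_def)

lemma subspace_R: "s \<in> S \<Longrightarrow> subspace (R s)"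
  using decomposition by (simp add: direct_sum_decomposition_def)

lemma zero_in_R: "s \<in> S \<Longrightarrow> 0 \<in> R s"
  using subspace_R subspace_0 by blast

lemma scale_in_R: "\<lbrakk>s \<in> S; x \<in> R s\<rbrakk> \<Longrightarrow> c *s x \<in> R s"
  using subspace_R subspace_scale by blast

definition component :: "'i \<Rightarrow> 'a \<Rightarrow> 'a" where
  "component s x = (THE f. f \<in> (\<Pi>\<^sub>E s\<in>S. R s) \<and> x = (\<Sum>s\<in>S. f s)) s"

lemma ex1_components: "\<exists>!f. f \<in> (\<Pi>\<^sub>E s\<in>S. R s) \<and> x = (\<Sum>s\<in>S. f s)"
  using decomposition by (simp add: direct_sum_decomposition_def)

lemma component_in: "s \<in> S \<Longrightarrow> component s x \<in> R s"
  using theI' [OF ex1_components [of x]] unfolding component_def by (auto simp: PiE_iff)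

lemma sum_components: "(\<Sum>s\<in>S. component s x) = x"
  using theI' [OF ex1_components [of x]] unfolding component_def by simp

lemma component_eqI:
  assumes "\<And>s. s \<in> S \<Longrightarrow> y s \<in> R s" and "(\<Sum>s\<in>S. y s) = x" and "s \<in> S"
  shows "component s x = y s"
proof -
  have "restrict y S = (THE f. f \<in> (\<Pi>\<^sub>E s\<in>S. R s) \<and> x = (\<Sum>s\<in>S. f s))"
    by (rule the1_equality [OF ex1_components, symmetric]) (use assms(1,2) in auto)
  then show ?thesis
    using assms(3) unfolding component_def by (metis restrict_apply')
qed

lemma component_homogeneous:
  assumes "s \<in> S" "t \<in> S" "x \<in> R s"
  shows "component t x = (if t = s then x else 0)"
  by (rule component_eqI [where y = "\<lambda>t. if t = s then x else 0"]) (use assms in \<open>auto simp: zero_in_R\<close>)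

lemma homogeneous_unique:
  assumes "s \<in> S" "t \<in> S" "x \<in> R s" "x \<in> R t" "x \<noteq> 0"
  shows "s = t"
  using component_homogeneous [of s t x] component_homogeneous [of t t x] assms
  by (metis (full_types))

lemma nonzero_word:
  assumes "set is \<subseteq> S"
  obtains as where "list_all2 (\<lambda>a i. a \<in> R i) as is" "prod_list as \<noteq> 0"
proof -
  have "\<forall>is. set is \<subseteq> S \<longrightarrow> (\<exists>as. list_all2 (\<lambda>a i. a \<in> R i) as is \<and> prod_list as \<noteq> 0)"
    using regular unfolding regular_quantum_commutative_def by (elim conjE)
  then obtain as where "list_all2 (\<lambda>a i. a \<in> R i) as is \<and> prod_list as \<noteq> 0"
    using assms by (elim allE impE exE)
  then show thesis
    using that by (elim conjE)
qed

lemma nonzero_word3: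
  assumes "s \<in> S" "t \<in> S" "u \<in> S"
  obtains a b c where "a \<in> R s" "b \<in> R t" "c \<in> R u" "a * b * c \<noteq> 0"
proof -
  have "set [s, t, u] \<subseteq> S"
    using assms by simp
  then obtain as where as: "list_all2 (\<lambda>a i. a \<in> R i) as [s, t, u]" "prod_list as \<noteq> 0"
    by (rule nonzero_word)
  from as(1) obtain a b c where "as = [a, b, c]" "a \<in> R s" "b \<in> R t" "c \<in> R u"
    by (auto simp: list_all2_Cons2)
  with as(2) show thesis
    by (intro that [of a b c]) (simp_all add: mult.assoc)
qed

lemma nonzero_word2:
  assumes "s \<in> S" "t \<in> S"
  obtains a b where "a \<in> R s" "b \<in> R t" "a * b \<noteq> 0"
proof -
  obtain a b c where "a \<in> R s" "b \<in> R t" "a * b * c \<noteq> 0"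
    using nonzero_word3 [OF assms assms(2)] .
  then show thesis
    using that [of a b] mult_zero_left by metis
qed

lemma \<theta>_nonzero: "\<lbrakk>s \<in> S; t \<in> S\<rbrakk> \<Longrightarrow> \<theta> s t \<noteq> 0"
  using regular unfolding regular_quantum_commutative_def by blast

lemma quantum_commute: "\<lbrakk>s \<in> S; t \<in> S; a \<in> R s; b \<in> R t\<rbrakk> \<Longrightarrow> a * b = \<theta> s t *s (b * a)"
  using regular unfolding regular_quantum_commutative_def by blast

text \<open>
  The function \<open>f\<close> with \<open>R s R t \<subseteq> R (f (s, t))\<close>. Regularity for words of length two makes it total,
  and for words of length three associative.
\<close>

definition degree_mult :: "'i \<Rightarrow> 'i \<Rightarrow> 'i" where
  "degree_mult s t = (SOME u. u \<in> S \<and> (\<forall>a\<in>R s. \<forall>b\<in>R t. a * b \<in> R u))"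

lemma degree_mult:
  assumes "s \<in> S" "t \<in> S"
  shows "degree_mult s t \<in> S"
    and "\<lbrakk>a \<in> R s; b \<in> R t\<rbrakk> \<Longrightarrow> a * b \<in> R (degree_mult s t)"
proof -
  obtain a\<^sub>0 b\<^sub>0 where ab: "a\<^sub>0 \<in> R s" "b\<^sub>0 \<in> R t" "a\<^sub>0 * b\<^sub>0 \<noteq> 0"
    using nonzero_word2 [OF assms] .
  have "\<forall>s\<in>S. \<forall>t\<in>S. (\<forall>a\<in>R s. \<forall>b\<in>R t. a * b = 0) \<or> (\<exists>u\<in>S. \<forall>a\<in>R s. \<forall>b\<in>R t. a * b \<in> R u)"
    using grading unfolding set_grading_def by (elim conjE)
  then have "(\<forall>a\<in>R s. \<forall>b\<in>R t. a * b = 0) \<or> (\<exists>u\<in>S. \<forall>a\<in>R s. \<forall>b\<in>R t. a * b \<in> R u)"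
    using assms by (elim ballE) auto
  then have "\<exists>u. u \<in> S \<and> (\<forall>a\<in>R s. \<forall>b\<in>R t. a * b \<in> R u)"
    using ab by auto
  then have *: "degree_mult s t \<in> S \<and> (\<forall>a\<in>R s. \<forall>b\<in>R t. a * b \<in> R (degree_mult s t))"
    unfolding degree_mult_def by (rule someI_ex)
  show "degree_mult s t \<in> S"
    using * by blast
  show "\<lbrakk>a \<in> R s; b \<in> R t\<rbrakk> \<Longrightarrow> a * b \<in> R (degree_mult s t)"
    using * by blast
qed

lemma degree_mult_eqI:
  assumes "s \<in> S" "t \<in> S" "u \<in> S" "a \<in> R s" "b \<in> R t" "a * b \<noteq> 0" "a * b \<in> R u"
  shows "degree_mult s t = u"
  using homogeneous_unique [of "degree_mult s t" u "a * b"] degree_mult assms by auto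

lemma degree_mult_assoc:
  assumes "s \<in> S" "t \<in> S" "u \<in> S"
  shows "degree_mult (degree_mult s t) u = degree_mult s (degree_mult t u)"
proof -
  obtain a b c where abc: "a \<in> R s" "b \<in> R t" "c \<in> R u" and ne: "a * b * c \<noteq> 0"
    using nonzero_word3 [OF assms] .
  have "a * b * c \<in> R (degree_mult s (degree_mult t u))"
    unfolding mult.assoc using abc assms by (intro degree_mult)
  then show ?thesis
    using abc ne assms degree_mult by (intro degree_mult_eqI [of _ _ _ "a * b" c]) auto
qed

lemma degree_mult_commute:
  assumes "s \<in> S" "t \<in> S"
  shows "degree_mult s t = degree_mult t s"
proof -
  obtain a b where ab: "a \<in> R s" "b \<in> R t" and ne: "a * b \<noteq> 0"
    using nonzero_word2 [OF assms] .
  have "b * a \<in> R (degree_mult t s)"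
    using ab assms by (intro degree_mult)
  then have "\<theta> s t *s (b * a) \<in> R (degree_mult t s)"
    using degree_mult(1) assms by (intro scale_in_R)
  then have "a * b \<in> R (degree_mult t s)"
    using quantum_commute [OF assms ab] by simp
  then show ?thesis
    using ab ne assms degree_mult by (intro degree_mult_eqI [of _ _ _ a b]) auto
qed

text \<open>Moving \<open>c\<close> past \<open>a b\<close> at once or in two steps gives the same factor, as \<open>a b c \<noteq> 0\<close> for some choice.\<close>

lemma \<theta>_mult:
  assumes "s \<in> S" "t \<in> S" "u \<in> S"
  shows "\<theta> (degree_mult s t) u = \<theta> s u * \<theta> t u"
proof -
  obtain a b c where abc: "a \<in> R s" "b \<in> R t" "c \<in> R u" and ne: "a * b * c \<noteq> 0"
    using nonzero_word3 [OF assms] .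
  have 1: "a * b * c = \<theta> (degree_mult s t) u *s (c * (a * b))"
    using abc assms degree_mult by (intro quantum_commute) auto
  have "a * b * c = a * (b * c)"
    by (rule mult.assoc)
  also have "\<dots> = \<theta> t u *s ((a * c) * b)"
    by (simp only: quantum_commute [OF assms(2,3) abc(2,3)] scale_mult_right
      mult.assoc [of a, symmetric])
  also have "\<dots> = (\<theta> s u * \<theta> t u) *s (c * (a * b))"
    by (simp only: quantum_commute [OF assms(1,3) abc(1,3)] scale_mult_left scale_scale
      mult.assoc [of c] mult.commute [of "\<theta> t u" "\<theta> s u"])
  finally have "\<theta> (degree_mult s t) u *s (c * (a * b)) = (\<theta> s u * \<theta> t u) *s (c * (a * b))"
    unfolding 1 .
  moreover have "c * (a * b) \<noteq> 0"
    using 1 ne by auto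
  ultimately show ?thesis
    by (simp add: scale_cancel_right)
qed

lemma \<theta>_skew:
  assumes "s \<in> S" "t \<in> S"
  shows "\<theta> s t * \<theta> t s = 1"
proof -
  obtain a b where ab: "a \<in> R s" "b \<in> R t" and ne: "a * b \<noteq> 0"
    using nonzero_word2 [OF assms] .
  have "a * b = \<theta> s t *s (b * a)"
    by (rule quantum_commute [OF assms ab])
  also have "b * a = \<theta> t s *s (a * b)"
    by (rule quantum_commute [OF assms(2,1) ab(2,1)])
  finally have "1 *s (a * b) = (\<theta> s t * \<theta> t s) *s (a * b)"
    by (simp only: scale_scale scale_one)
  then show ?thesis
    using ne unfolding scale_cancel_right by simp
qed

lemma \<theta>_row_injective:
  assumes "s \<in> S" "t \<in> S" and eq: "\<And>u. u \<in> S \<Longrightarrow> \<theta> s u = \<theta> t u"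
  shows "s = t"
proof (rule ccontr)
  assume "s \<noteq> t"
  then obtain u where u: "u \<in> S" "\<theta> u s \<noteq> \<theta> u t"
    using minimal assms unfolding minimal_matrix_def by blast
  have "\<theta> u s = inverse (\<theta> s u)" "\<theta> u t = inverse (\<theta> t u)"
    using \<theta>_skew [of s u] \<theta>_skew [of t u] u assms by (auto intro: inverse_unique [symmetric])
  then show False
    using u eq by simp
qed

text \<open>
  By minimality \<open>s \<mapsto> \<theta> s\<close> embeds the finite semigroup of degrees into a group of functions,
  so it is cancellative and hence a group.
\<close>

lemma degree_mult_cancel:
  assumes "s \<in> S" "t \<in> S" "u \<in> S" "degree_mult u s = degree_mult u t"
  shows "s = t"
proof (rule \<theta>_row_injective [OF assms(1,2)])
  fix v assume v: "v \<in> S"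
  have "\<theta> u v \<noteq> 0"
    using \<theta>_nonzero assms(3) v .
  moreover have "\<theta> u v * \<theta> s v = \<theta> u v * \<theta> t v"
    unfolding \<theta>_mult [OF assms(3,1) v, symmetric] \<theta>_mult [OF assms(3,2) v, symmetric]
    by (simp only: assms(4))
  ultimately show "\<theta> s v = \<theta> t v"
    by simp
qed

lemma degree_mult_surj:
  assumes "u \<in> S" "t \<in> S"
  obtains s where "s \<in> S" "degree_mult u s = t"
proof -
  have "inj_on (degree_mult u) S"
    using degree_mult_cancel assms by (auto intro: inj_onI)
  moreover have "degree_mult u ` S \<subseteq> S"
    using degree_mult(1) assms by auto
  ultimately have "degree_mult u ` S = S"
    by (simp add: endo_inj_surj)
  then show thesis
    using assms that by (metis imageE)
qed

lemma S_nonempty: "S \<noteq> {}"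
  using sum_components [of 1] by auto

lemma ex_degree_one: "\<exists>e. e \<in> S \<and> (\<forall>s\<in>S. degree_mult e s = s)"
proof -
  obtain u where u: "u \<in> S"
    using S_nonempty by blast
  obtain e where e: "e \<in> S" "degree_mult u e = u"
    using degree_mult_surj [OF u u] .
  have "degree_mult e s = s" if s: "s \<in> S" for s
  proof (rule degree_mult_cancel [of _ _ u])
    show "degree_mult u (degree_mult e s) = degree_mult u s"
      using degree_mult_assoc [of u e s] u e s by simp
  qed (use u e s degree_mult(1) in auto)
  then show ?thesis
    using e by blast
qed

definition degree_one :: 'i where
  "degree_one = (SOME e. e \<in> S \<and> (\<forall>s\<in>S. degree_mult e s = s))"

lemma degree_one: "degree_one \<in> S" "s \<in> S \<Longrightarrow> degree_mult degree_one s = s"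
  using someI_ex [OF ex_degree_one] unfolding degree_one_def by blast+

definition degree_group :: "'i monoid" where
  "degree_group = \<lparr>carrier = S, mult = degree_mult, one = degree_one\<rparr>"

lemma degree_group_simps [simp]:
  "carrier degree_group = S" "mult degree_group = degree_mult" "one degree_group = degree_one"
  by (simp_all add: degree_group_def)

lemma comm_group_degree_group: "comm_group degree_group"
proof (rule comm_groupI)
  fix s assume "s \<in> carrier degree_group"
  then show "\<exists>t\<in>carrier degree_group. t \<otimes>\<^bsub>degree_group\<^esub> s = \<one>\<^bsub>degree_group\<^esub>"
    using degree_mult_surj [of s degree_one] degree_one(1) degree_mult_commute [of s]
    by (metis degree_group_simps)
next
  fix s t assume "s \<in> carrier degree_group" "t \<in> carrier degree_group"
  then show "s \<otimes>\<^bsub>degree_group\<^esub> t = t \<otimes>\<^bsub>degree_group\<^esub> s"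
    using degree_mult_commute by simp
qed (use degree_mult(1) degree_mult_assoc degree_one in simp_all)

lemma group_grading_degree_group: "group_grading S R degree_group"
  unfolding group_grading_def
proof (intro conjI grading exI [of _ id] ballI impI)
  show "group degree_group"
    using comm_group_degree_group by (simp add: comm_group_def)
  fix s t u
  assume "s \<in> S" "t \<in> S" "u \<in> S"
    and "(\<exists>a\<in>R s. \<exists>b\<in>R t. a * b \<noteq> 0) \<and> (\<forall>a\<in>R s. \<forall>b\<in>R t. a * b \<in> R u)"
  then show "id u = id s \<otimes>\<^bsub>degree_group\<^esub> id t"
    using degree_mult_eqI [of s t u] by auto
qed simp_all

lemma \<theta>_one: "s \<in> S \<Longrightarrow> \<theta> degree_one s = 1"
  using \<theta>_mult [of degree_one degree_one s] \<theta>_nonzero [of degree_one s] degree_one by simp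

lemma degree_one_central:
  assumes "x \<in> R degree_one"
  shows "x * y = y * x"
proof -
  have "x * component s y = component s y * x" if "s \<in> S" for s
    using quantum_commute [OF degree_one(1) that assms component_in [OF that]] \<theta>_one that by simp
  then have "(\<Sum>s\<in>S. x * component s y) = (\<Sum>s\<in>S. component s y * x)"
    by simp
  then have "x * (\<Sum>s\<in>S. component s y) = (\<Sum>s\<in>S. component s y) * x"
    by (simp only: sum_distrib_left sum_distrib_right)
  then show ?thesis
    by (simp only: sum_components)
qed

text \<open>
  Multiplication by an element of degree \<open>t\<close> permutes the components, since the translation by \<open>t\<close>
  is a bijection of the degrees.
\<close>

lemma component_mult:
  assumes t: "t \<in> S" "b \<in> R t" and s: "s \<in> S"
  shows "component (degree_mult s t) (x * b) = component s x * b"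
proof -
  have bij: "bij_betw (\<lambda>s. degree_mult s t) S S"
  proof (rule bij_betwI')
    show "degree_mult s t = degree_mult u t \<longleftrightarrow> s = u" if "s \<in> S" "u \<in> S" for s u
      using degree_mult_cancel [of s u t] degree_mult_commute t that by metis
    show "\<exists>s\<in>S. u = degree_mult s t" if "u \<in> S" for u
      using degree_mult_surj [of t u] degree_mult_commute t that by metis
  qed (use degree_mult t in auto)
  let ?inv = "the_inv_into S (\<lambda>s. degree_mult s t)"
  have inv: "?inv (degree_mult s t) = s" if "s \<in> S" for s
    using the_inv_into_f_f [OF bij_betw_imp_inj_on [OF bij] that] .
  have "component (degree_mult s t) (x * b) = component (?inv (degree_mult s t)) x * b"
  proof (rule component_eqI [where y = "\<lambda>u. component (?inv u) x * b"])
    fix u assume "u \<in> S"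
    then obtain s where s: "s \<in> S" "u = degree_mult s t"
      using bij by (metis bij_betw_imp_surj_on imageE)
    show "component (?inv u) x * b \<in> R u"
      unfolding s(2) inv [OF s(1)] using s(1) t by (intro degree_mult component_in)
  next
    have "(\<Sum>u\<in>S. component (?inv u) x * b) = (\<Sum>s\<in>S. component (?inv (degree_mult s t)) x * b)"
      by (rule sum.reindex_bij_betw [OF bij, symmetric])
    also have "\<dots> = (\<Sum>s\<in>S. component s x * b)"
      using inv by simp
    also have "\<dots> = x * b"
      by (simp only: sum_components flip: sum_distrib_right)
    finally show "(\<Sum>u\<in>S. component (?inv u) x * b) = x * b" .
  qed (use s t degree_mult in auto)
  then show ?thesis
    by (simp only: inv [OF s])
qed

text \<open>
  By quantum commutativity \<open>b x = y b\<close>, where \<open>y\<close> arises from \<open>x\<close> by rescaling each component.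
\<close>

lemma component_mult_left:
  assumes t: "t \<in> S" "b \<in> R t" and s: "s \<in> S"
  shows "component (degree_mult s t) (b * x) = b * component s x"
proof -
  define y where "y = (\<Sum>u\<in>S. \<theta> t u *s component u x)"
  have comp: "component u y = \<theta> t u *s component u x" if "u \<in> S" for u
    by (rule component_eqI [where y = "\<lambda>u. \<theta> t u *s component u x"])
      (use that in \<open>auto simp: y_def intro: scale_in_R component_in\<close>)
  have commute: "b * component u x = \<theta> t u *s (component u x * b)" if "u \<in> S" for u
    using quantum_commute [OF t(1) that t(2) component_in [OF that]] .
  have "b * x = (\<Sum>u\<in>S. b * component u x)"
    by (simp only: sum_components flip: sum_distrib_left)
  also have "\<dots> = y * b"
    by (simp add: y_def sum_distrib_right scale_mult_left commute)
  finally have "component (degree_mult s t) (b * x) = component s y * b"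
    using component_mult [OF t s] by simp
  then show ?thesis
    by (simp only: comp [OF s] commute [OF s] scale_mult_left)
qed

text \<open>The component of \<open>1\<close> of trivial degree is a left identity on all homogeneous elements.\<close>

lemma one_homogeneous: "1 \<in> R degree_one"
proof -
  have "x = component degree_one 1 * x" if "s \<in> S" "x \<in> R s" for s x
    using component_mult [OF that degree_one(1), of 1] degree_one(2) component_homogeneous [of s s x] that
    by simp
  then have "component s x = component degree_one 1 * component s x" if "s \<in> S" for s x
    using that component_in by blast
  then have "(\<Sum>s\<in>S. component s 1) = (\<Sum>s\<in>S. component degree_one 1 * component s 1)"
    by simp
  also have "\<dots> = component degree_one 1"
    by (simp only: sum_components mult_1_right flip: sum_distrib_left)
  finally have "1 = component degree_one 1"
    by (simp only: sum_components)
  then show ?thesis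
    using component_in [OF degree_one(1), of 1] by simp
qed

lemma degree_group_pow_closed: "s \<in> S \<Longrightarrow> s [^]\<^bsub>degree_group\<^esub> (n::nat) \<in> S"
  by (induction n) (simp_all add: degree_one degree_mult)

lemma homogeneous_pow:
  assumes "s \<in> S" "x \<in> R s"
  shows "x ^ n \<in> R (s [^]\<^bsub>degree_group\<^esub> (n::nat))"
proof (induction n)
  case (Suc n)
  have "x ^ n * x \<in> R (degree_mult (s [^]\<^bsub>degree_group\<^esub> n) s)"
    using Suc assms degree_group_pow_closed by (intro degree_mult)
  then show ?case
    by (simp add: power_commutes)
qed (simp add: one_homogeneous)

end

section \<open>The structure of a semisimple quantum commutative grading\<close>

locale semisimple_quantum_commutative_grading =
  quantum_commutative_grading scale S R \<theta> + semisimple_algebra scale Basis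
  for scale :: "'k::alg_closed_field \<Rightarrow> 'a::ring_1 \<Rightarrow> 'a" (infixr \<open>*s\<close> 75)
    and S :: "'i set" and R \<theta> Basis
begin

sublocale finite_dimensional_algebra scale Basis
  by unfold_locales

text \<open>Since \<open>x A = A x\<close>, a homogeneous \<open>x\<close> of square zero generates an ideal of square zero.\<close>

lemma homogeneous_square_nonzero:
  assumes s: "s \<in> S" "x \<in> R s" and "x \<noteq> 0"
  shows "x * x \<noteq> 0"
proof
  assume sq: "x * x = 0"
  define N where "N = range (\<lambda>r. r * x)"
  have swap: "\<exists>b'. x * b = b' * x" for b
  proof -
    have "x * component t b = (\<theta> s t *s component t b) * x" if "t \<in> S" for t
      using quantum_commute [OF s(1) that s(2) component_in [OF that]] by (simp add: scale_mult_left)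
    then have "(\<Sum>t\<in>S. x * component t b) = (\<Sum>t\<in>S. (\<theta> s t *s component t b) * x)"
      by simp
    then have "x * b = (\<Sum>t\<in>S. \<theta> s t *s component t b) * x"
      by (simp only: sum_components flip: sum_distrib_left sum_distrib_right)
    then show ?thesis
      by blast
  qed
  have "subspace N"
  proof (rule subspaceI)
    show "0 \<in> N"
      using rangeI [of "\<lambda>r. r * x" 0] by (simp add: N_def)
  next
    fix y z c
    assume "y \<in> N"
    then obtain a where a: "y = a * x"
      by (auto simp: N_def)
    show "c *s y \<in> N"
      using rangeI [of "\<lambda>r. r * x" "c *s a"] by (simp add: N_def a scale_mult_left)
    assume "z \<in> N"
    then obtain b where b: "z = b * x"
      by (auto simp: N_def)
    show "y + z \<in> N"
      using rangeI [of "\<lambda>r. r * x" "a + b"] by (simp add: N_def a b distrib_right)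
  qed
  moreover have "b * y \<in> N \<and> y * b \<in> N" if "y \<in> N" for b y
  proof -
    obtain a where a: "y = a * x"
      using \<open>y \<in> N\<close> by (auto simp: N_def)
    obtain b' where "x * b = b' * x"
      using swap by blast
    then have "y * b = (a * b') * x"
      by (simp add: a mult.assoc)
    moreover have "b * y = (b * a) * x"
      by (simp add: a mult.assoc)
    ultimately show ?thesis
      unfolding N_def by blast
  qed
  ultimately have "ideal_of UNIV N"
    by (simp add: ideal_of_def)
  moreover have "y * z = 0" if "y \<in> N" "z \<in> N" for y z
  proof -
    obtain a where a: "y = a * x"
      using \<open>y \<in> N\<close> by (auto simp: N_def)
    obtain b where b: "z = b * x"
      using \<open>z \<in> N\<close> by (auto simp: N_def)
    obtain b' where "x * b = b' * x"
      using swap by blast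
    then have "y * z = a * b' * (x * x)"
      by (simp add: a b mult.assoc) (simp flip: mult.assoc)
    then show ?thesis
      by (simp add: sq)
  qed
  ultimately have "N = {0}"
    by (rule square_zero_ideal)
  moreover have "x \<in> N"
    using rangeI [of "\<lambda>r. r * x" 1] by (simp add: N_def)
  ultimately show False
    using \<open>x \<noteq> 0\<close> by simp
qed

text \<open>Repeated squaring never gives zero, and every power divides one of the form \<open>x ^ 2 ^ k\<close>.\<close>

lemma homogeneous_pow_nonzero:
  assumes s: "s \<in> S" "x \<in> R s" and "x \<noteq> 0"
  shows "x ^ n \<noteq> 0"
proof -
  have "x ^ (2 ^ k) \<noteq> 0" for k
  proof (induction k)
    case (Suc k)
    have "x ^ (2 ^ k) * x ^ (2 ^ k) \<noteq> 0"
      using homogeneous_pow [OF s] degree_group_pow_closed [OF s(1)] Suc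
      by (intro homogeneous_square_nonzero)
    then show ?case
      by (simp add: mult_2 power_add)
  qed (use \<open>x \<noteq> 0\<close> in simp)
  moreover have "x ^ (2 ^ n) = x ^ n * x ^ (2 ^ n - n)"
    using less_exp [of n] by (simp flip: power_add)
  ultimately show ?thesis
    by (metis mult_zero_left)
qed

lemma \<theta>_alternating:
  assumes "s \<in> S"
  shows "\<theta> s s = 1"
proof -
  obtain a b where a: "a \<in> R s" and "a * b \<noteq> 0"
    using nonzero_word2 [OF assms assms] .
  then have "a \<noteq> 0"
    by auto
  then have "a * a \<noteq> 0"
    using homogeneous_square_nonzero assms a by blast
  moreover have "1 *s (a * a) = \<theta> s s *s (a * a)"
    using quantum_commute [OF assms assms a a] by simp
  ultimately show ?thesis
    unfolding scale_cancel_right by simp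
qed

lemma alternating_bicharacter_degree_group: "alternating_bicharacter degree_group \<theta>"
proof (intro alternating_bicharacter.intro alternating_bicharacter_axioms.intro comm_group_degree_group)
  fix s assume s: "s \<in> carrier degree_group" and triv: "\<And>t. t \<in> carrier degree_group \<Longrightarrow> \<theta> s t = 1"
  show "s = \<one>\<^bsub>degree_group\<^esub>"
    unfolding degree_group_simps
    by (rule \<theta>_row_injective) (use s triv degree_one(1) \<theta>_one in auto)
qed (simp_all add: \<theta>_nonzero \<theta>_mult \<theta>_skew \<theta>_alternating)

text \<open>A central idempotent can be moved next to any factor of a product.\<close>

lemma central_idempotent_prod_list:
  assumes e: "central_idempotent e" and "prod_list as * e \<noteq> 0" and "a \<in> set as"
  shows "a * e \<noteq> 0"
  using assms(2,3)
proof (induction as)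
  case (Cons b bs)
  have 1: "prod_list (b # bs) * e = (b * e) * prod_list bs"
    by (simp add: mult.assoc central_idempotentD(2) [OF e, of "prod_list bs"])
  have 2: "prod_list (b # bs) * e = b * (prod_list bs * e)"
    by (simp add: mult.assoc)
  show ?case
  proof (cases "a = b")
    case True
    then show ?thesis using 1 Cons.prems by auto
  next
    case False
    then have "prod_list bs * e \<noteq> 0" "a \<in> set bs"
      using 2 Cons.prems by auto
    then show ?thesis by (rule Cons.IH)
  qed
qed simp

text \<open>
  The ideal \<open>y A\<close> is graded, as \<open>y\<close> has trivial degree. So it contains the components of its identity
  \<open>f\<close>, and comparing degrees in \<open>f f\<^sub>s = f\<^sub>s\<close> shows that the component of trivial degree is an
  identity as well; identities are unique.
\<close>

lemma ideal_identity_degree_one: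
  assumes y: "y \<in> R degree_one" and f: "central_idempotent f" and eq: "corner f = range ((*) y)"
  shows "f \<in> R degree_one"
proof -
  obtain r where r: "f = y * r"
    using corner_self [OF f] eq by blast
  have comp: "component s f = y * component s r" if "s \<in> S" for s
    using component_mult_left [OF degree_one(1) y that, of r] degree_mult_commute [OF that degree_one(1)]
      degree_one(2) [OF that] r by simp
  have absorb: "component degree_one f * component s f = component s f" if s: "s \<in> S" for s
  proof -
    have "component s f \<in> corner f"
      using comp [OF s] eq by blast
    then have "f * component s f = component s f"
      using f by (simp add: corner_iff)
    then show ?thesis
      using component_mult [OF s component_in [OF s, of f] degree_one(1), of f]
        degree_one(2) [OF s] component_homogeneous [OF s s component_in [OF s, of f]] by simp
  qed
  have "component degree_one f * f = (\<Sum>s\<in>S. component degree_one f * component s f)"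
    by (simp only: sum_components flip: sum_distrib_left)
  also have "\<dots> = (\<Sum>s\<in>S. component s f)"
    by (rule sum.cong) (auto simp: absorb)
  also have "\<dots> = f"
    by (rule sum_components)
  finally have "component degree_one f * f = f" .
  moreover have "f * component degree_one f = component degree_one f"
  proof -
    have "component degree_one f \<in> corner f"
      using comp [OF degree_one(1)] eq by blast
    then show ?thesis
      using f by (simp add: corner_iff)
  qed
  ultimately have "f = component degree_one f"
    using central_idempotentD(2) [OF f, of "component degree_one f"] by simp
  then show ?thesis
    using component_in [OF degree_one(1), of f] by simp
qed

lemma ideal_of_range_central:
  assumes "\<And>x. y * x = x * y"
  shows "ideal_of UNIV (range ((*) y))"
proof -
  have "b * (y * a) = y * (b * a)" for a b
    using assms [of b] by (simp flip: mult.assoc)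
  then have "b * (y * a) \<in> corner y" "(y * a) * b \<in> corner y" for a b
    unfolding corner_def by (simp_all add: mult.assoc)
  then show ?thesis
    using subspace_corner [of y] unfolding ideal_of_def corner_def by blast
qed

text \<open>
  Choose \<open>\<epsilon>\<close> among the idempotents of trivial degree that do not kill \<open>w\<close> so that \<open>dim (corner \<epsilon>)\<close> is
  minimal. If \<open>x\<close> of trivial degree lies in \<open>corner \<epsilon>\<close>, let \<open>c\<close> be an eigenvalue of the
  multiplication by \<open>x\<close> on \<open>corner \<epsilon>\<close>, and \<open>y = x - c \<epsilon>\<close>. The idempotent \<open>f\<close> generating the ideal
  \<open>y A\<close> again has trivial degree, and \<open>f \<noteq> \<epsilon>\<close> because \<open>y\<close> is a zero divisor in \<open>corner \<epsilon>\<close>. One of \<open>f\<close>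
  and \<open>\<epsilon> - f\<close> does not kill \<open>w\<close>, so minimality forces \<open>f = 0\<close>, and with it \<open>y = 0\<close>.
\<close>

lemma minimal_idempotent:
  assumes "w \<noteq> 0"
  obtains \<epsilon> where "central_idempotent \<epsilon>" "\<epsilon> \<in> R degree_one" "w * \<epsilon> \<noteq> 0"
    and "\<forall>x\<in>R degree_one. \<epsilon> * x = x \<longrightarrow> (\<exists>c. x = c *s \<epsilon>)"
proof -
  define P where "P e \<longleftrightarrow> central_idempotent e \<and> e \<in> R degree_one \<and> w * e \<noteq> 0" for e
  have "P 1"
    using \<open>w \<noteq> 0\<close> one_homogeneous by (simp add: P_def central_idempotent_def)
  then obtain \<epsilon> where \<epsilon>: "P \<epsilon>" and min: "\<And>f. P f \<Longrightarrow> dim (corner \<epsilon>) \<le> dim (corner f)"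
    using ex_has_least_nat [of P 1 "\<lambda>e. dim (corner e)"] by blast
  have ce: "central_idempotent \<epsilon>" and hom: "\<epsilon> \<in> R degree_one" and w: "w * \<epsilon> \<noteq> 0"
    using \<epsilon> by (auto simp: P_def)
  note idem = central_idempotentD(1) [OF ce]
  have sub: "subspace (R degree_one)"
    by (rule subspace_R [OF degree_one(1)])
  have "\<exists>c. x = c *s \<epsilon>" if x: "x \<in> R degree_one" and \<epsilon>x: "\<epsilon> * x = x" for x
  proof -
    have "\<epsilon> \<noteq> 0"
      using w by auto
    then obtain c q where z0: "q * \<epsilon> \<noteq> 0" and eig: "x * (q * \<epsilon>) = c *s (q * \<epsilon>)"
      by (rule left_mult_eigenvector)
    define y z where "y = x - c *s \<epsilon>" and "z = q * \<epsilon>"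
    have \<epsilon>z: "\<epsilon> * z = z"
      using central_idempotentD(2) [OF ce, of z] by (simp add: z_def mult.assoc idem)
    have yz: "y * z = 0"
      using eig \<epsilon>z by (simp add: y_def left_diff_distrib scale_mult_left flip: z_def)
    have y: "y \<in> R degree_one"
      using x hom sub unfolding y_def by (intro subspace_diff subspace_scale)
    have \<epsilon>y: "\<epsilon> * y = y"
      using \<epsilon>x by (simp add: y_def right_diff_distrib scale_mult_right idem)
    obtain f where f: "central_idempotent f" and eq: "corner f = range ((*) y)"
      using ideal_eq_corner [OF ideal_of_range_central [OF degree_one_central [OF y]]] by metis
    have fhom: "f \<in> R degree_one"
      using ideal_identity_degree_one [OF y f eq] .
    obtain r where r: "f = y * r"
      using corner_self [OF f] eq by blast
    have \<epsilon>f: "\<epsilon> * f = f"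
      unfolding r by (simp only: \<epsilon>y flip: mult.assoc)
    have "f * z = r * (y * z)"
      unfolding r by (simp only: degree_one_central [OF y, of r] mult.assoc)
    then have "f \<noteq> \<epsilon>"
      using yz \<epsilon>z z0 z_def by auto
    then have "\<not> P f"
      using min [of f] dim_corner_less [OF ce f \<epsilon>f] by auto
    then have "w * f = 0"
      using f fhom by (simp add: P_def)
    then have "w * (\<epsilon> - f) \<noteq> 0"
      using w by (simp add: right_diff_distrib)
    moreover have d: "central_idempotent (\<epsilon> - f)"
      using central_idempotent_diff [OF ce f \<epsilon>f] .
    moreover have "\<epsilon> - f \<in> R degree_one"
      using hom fhom sub by (intro subspace_diff)
    ultimately have "P (\<epsilon> - f)"
      by (simp add: P_def)
    then have "\<epsilon> - f = \<epsilon>"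
      using min [of "\<epsilon> - f"] dim_corner_less [OF ce d] \<epsilon>f idem by (force simp: right_diff_distrib)
    then have "f = 0"
      by simp
    then have "range ((*) y) = {0}"
      using eq by simp
    then have "y = 0"
      using rangeI [of "(*) y" 1] by simp
    then show ?thesis
      unfolding y_def by auto
  qed
  then show thesis
    using that ce hom w by blast
qed

text \<open>
  Regularity, applied to a word in which every degree occurs, gives the product \<open>w\<close> for the previous
  lemma. As \<open>\<epsilon>\<close> does not kill \<open>w\<close>, it does not kill any factor, so \<open>corner \<epsilon>\<close> meets every \<open>R s\<close>.
\<close>

lemma full_support_component:
  obtains \<epsilon> u where "central_idempotent \<epsilon>" "\<epsilon> \<in> R degree_one" "\<epsilon> \<noteq> 0"
    and "\<forall>x\<in>R degree_one. \<epsilon> * x = x \<longrightarrow> (\<exists>c. x = c *s \<epsilon>)"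
    and "\<forall>s\<in>S. u s \<in> R s \<and> u s \<noteq> 0 \<and> \<epsilon> * u s = u s"
proof -
  obtain ss where ss: "set ss = S"
    using finite_list [OF finite_S] by blast
  then obtain as where as: "list_all2 (\<lambda>a i. a \<in> R i) as ss" and w: "prod_list as \<noteq> 0"
    using nonzero_word [of ss] by blast
  obtain \<epsilon> where \<epsilon>: "central_idempotent \<epsilon>" "\<epsilon> \<in> R degree_one" "prod_list as * \<epsilon> \<noteq> 0"
    and line: "\<forall>x\<in>R degree_one. \<epsilon> * x = x \<longrightarrow> (\<exists>c. x = c *s \<epsilon>)"
    using minimal_idempotent [OF w] .
  have "\<exists>u. u \<in> R s \<and> u \<noteq> 0 \<and> \<epsilon> * u = u" if s: "s \<in> S" for s
  proof -
    obtain i where i: "i < length ss" "ss ! i = s"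
      using s ss by (metis in_set_conv_nth)
    then have a: "as ! i \<in> R s" "as ! i \<in> set as"
      using as by (auto simp: list_all2_conv_all_nth)
    have "as ! i * \<epsilon> \<noteq> 0"
      using central_idempotent_prod_list [OF \<epsilon>(1,3) a(2)] .
    moreover have eq: "as ! i * \<epsilon> = \<epsilon> * as ! i"
      using central_idempotentD(2) [OF \<epsilon>(1)] by (rule sym)
    moreover have "\<epsilon> * (\<epsilon> * as ! i) = \<epsilon> * as ! i"
      by (simp only: central_idempotentD(1) [OF \<epsilon>(1)] flip: mult.assoc)
    moreover have "\<epsilon> * as ! i \<in> R s"
      using degree_mult(2) [OF degree_one(1) s \<epsilon>(2) a(1)] degree_one(2) [OF s] by simp
    ultimately show ?thesis
      by metis
  qed
  then have "\<exists>u. \<forall>s\<in>S. u s \<in> R s \<and> u s \<noteq> 0 \<and> \<epsilon> * u s = u s"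
    by (rule bchoice [OF ballI])
  then obtain u where u: "\<forall>s\<in>S. u s \<in> R s \<and> u s \<noteq> 0 \<and> \<epsilon> * u s = u s"
    by (elim exE)
  have "\<epsilon> \<noteq> 0"
    using \<epsilon>(3) by auto
  then show thesis
    using that [OF \<epsilon>(1,2) _ line u] by blast
qed

text \<open>
  In the algebra \<open>corner \<epsilon>\<close> just found, a nonzero homogeneous \<open>u\<close> has a power that is a nonzero multiple of \<open>\<epsilon>\<close>, so it is
  invertible, and multiplication by its inverse identifies \<open>corner \<epsilon> \<inter> R s\<close> with the line \<open>K \<epsilon>\<close>.
  The identity \<open>f\<close> of an ideal is central; comparing \<open>f u\<close> with \<open>u f\<close> for all these \<open>u\<close>, nondegeneracy of
  \<open>\<theta>\<close> confines \<open>f\<close> to trivial degree, so \<open>f\<close> is \<open>0\<close> or \<open>\<epsilon>\<close>.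
\<close>

lemma simple_component_of_dim_card:
  obtains B where "simple_component B" "dim B = card S"
proof -
  obtain \<epsilon> u where \<epsilon>: "central_idempotent \<epsilon>" "\<epsilon> \<in> R degree_one" "\<epsilon> \<noteq> 0"
    and line_all: "\<forall>x\<in>R degree_one. \<epsilon> * x = x \<longrightarrow> (\<exists>c. x = c *s \<epsilon>)"
    and u_all: "\<forall>s\<in>S. u s \<in> R s \<and> u s \<noteq> 0 \<and> \<epsilon> * u s = u s"
    using full_support_component .
  have line: "\<exists>c. x = c *s \<epsilon>" if "x \<in> R degree_one" "\<epsilon> * x = x" for x
    using line_all that by blast
  have u: "u s \<in> R s \<and> u s \<noteq> 0 \<and> \<epsilon> * u s = u s" if "s \<in> S" for s
    using u_all that by blast
  interpret G: comm_group degree_group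
    by (rule comm_group_degree_group)
  define n where "n = order degree_group"
  have "n > 0"
    unfolding n_def by (simp add: G.order_gt_0_iff_finite)
  then obtain m where m: "n = Suc m"
    using gr0_implies_Suc by blast
  (* v is a multiple of u s ^ (n - 1), where n is the order of the group, so its degree is inverse to s *)
  have inv: "\<exists>v. u s * v = \<epsilon> \<and> (\<forall>x. x \<in> R s \<longrightarrow> x * v \<in> R degree_one) \<and> v * u s = \<epsilon>"
    if s: "s \<in> S" for s
  proof -
    have us: "u s \<in> R s" "u s \<noteq> 0" "\<epsilon> * u s = u s"
      using u [OF s] by auto
    have pow: "s [^]\<^bsub>degree_group\<^esub> n = degree_one"
      using G.pow_order_eq_1 [of s] s by (simp add: n_def)
    have "u s ^ n \<in> R degree_one"
      using homogeneous_pow [OF s us(1), of n] pow by simp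
    moreover have "\<epsilon> * u s ^ n = u s ^ n"
      unfolding m power_Suc by (simp only: us(3) flip: mult.assoc)
    ultimately obtain c where c: "u s ^ n = c *s \<epsilon>"
      using line by blast
    have "u s ^ n \<noteq> 0"
      using homogeneous_pow_nonzero [OF s us(1,2)] .
    then have "c \<noteq> 0"
      using c by auto
    define v where "v = inverse c *s u s ^ m"
    have "u s * v = \<epsilon>"
      using c \<open>c \<noteq> 0\<close> by (simp add: v_def scale_mult_right m)
    moreover have "v * u s = \<epsilon>"
      using c \<open>c \<noteq> 0\<close> by (simp add: v_def scale_mult_left m power_commutes)
    moreover have "x * v \<in> R degree_one" if "x \<in> R s" for x
    proof -
      have "x * u s ^ m \<in> R (degree_mult s (s [^]\<^bsub>degree_group\<^esub> m))"
        using s that homogeneous_pow [OF s us(1)] degree_group_pow_closed by (intro degree_mult)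
      also have "degree_mult s (s [^]\<^bsub>degree_group\<^esub> m) = degree_one"
        using G.nat_pow_Suc2 [of s m] s pow m by simp
      finally show ?thesis
        unfolding v_def scale_mult_right using degree_one(1) by (intro scale_in_R)
    qed
    ultimately show ?thesis
      by blast
  qed
  have line_s: "\<exists>c. x = c *s u s" if s: "s \<in> S" and x: "x \<in> R s" "\<epsilon> * x = x" for s x
  proof -
    obtain v where v: "u s * v = \<epsilon>" "v * u s = \<epsilon>" and xv: "x * v \<in> R degree_one"
      using inv [OF s] x(1) by blast
    have "\<epsilon> * (x * v) = x * v"
      by (simp only: x(2) flip: mult.assoc)
    then obtain c where c: "x * v = c *s \<epsilon>"
      using line xv by blast
    have "x = x * \<epsilon>"
      using x(2) central_idempotentD(2) [OF \<epsilon>(1), of x] by simp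
    also have "\<dots> = (x * v) * u s"
      by (simp only: v(2) mult.assoc)
    also have "\<dots> = c *s u s"
      using u [OF s] by (simp add: c scale_mult_left)
    finally show ?thesis
      by blast
  qed
  have "inj_on u S"
    using u homogeneous_unique by (intro inj_onI) metis
  have ind: "independent (u ` S)"
  proof -
    have "c s = 0" if "(\<Sum>s\<in>S. c s *s u s) = 0" and s: "s \<in> S" for c s
    proof -
      have "component s 0 = c s *s u s"
        by (rule component_eqI [OF _ that]) (use u scale_in_R in blast)
      moreover have "component s 0 = 0"
        using component_homogeneous [OF s s zero_in_R [OF s]] by simp
      ultimately show ?thesis
        using u [OF s] by auto
    qed
    then have "c y = 0" if "(\<Sum>y\<in>u ` S. c y *s y) = 0" "y \<in> u ` S" for c y
      using that \<open>inj_on u S\<close> by (auto simp: sum.reindex)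
    then show ?thesis
      by (auto simp: independent_if_scalars_zero)
  qed
  have "u ` S \<subseteq> corner \<epsilon>"
    using u \<epsilon>(1) by (auto simp: corner_iff)
  moreover have "corner \<epsilon> \<subseteq> span (u ` S)"
  proof
    fix x assume "x \<in> corner \<epsilon>"
    then have "x = \<epsilon> * x"
      using \<epsilon>(1) by (simp add: corner_iff)
    also have "\<dots> = (\<Sum>s\<in>S. \<epsilon> * component s x)"
      by (simp only: sum_components flip: sum_distrib_left)
    also have "\<dots> \<in> span (u ` S)"
    proof (rule span_sum)
      fix s assume s: "s \<in> S"
      have "\<epsilon> * component s x \<in> R s"
        using degree_mult(2) [OF degree_one(1) s \<epsilon>(2) component_in [OF s]] degree_one(2) [OF s] by simp
      moreover have "\<epsilon> * (\<epsilon> * component s x) = \<epsilon> * component s x"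
        by (simp only: central_idempotentD(1) [OF \<epsilon>(1)] flip: mult.assoc)
      ultimately obtain c where "\<epsilon> * component s x = c *s u s"
        using line_s [OF s] by blast
      then show "\<epsilon> * component s x \<in> span (u ` S)"
        using s by (simp add: span_base span_scale)
    qed
    finally show "x \<in> span (u ` S)" .
  qed
  moreover have "card (u ` S) = card S"
    using \<open>inj_on u S\<close> by (rule card_image)
  ultimately have dim: "dim (corner \<epsilon>) = card S"
    using ind by (intro dim_unique)
  have "I = {0} \<or> I = corner \<epsilon>" if I: "ideal_of (corner \<epsilon>) I" for I
  proof -
    obtain f where f: "central_idempotent f" and I': "I = corner f"
      using ideal_eq_corner ideal_of_corner_imp_ideal [OF \<epsilon>(1) I] by blast
    have "f \<in> corner \<epsilon>"
      using I corner_self [OF f] I' unfolding ideal_of_def by blast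
    then have \<epsilon>f: "\<epsilon> * f = f"
      using \<epsilon>(1) by (simp add: corner_iff)
    have vanish: "component s f = 0" if s: "s \<in> S" and "s \<noteq> degree_one" for s
    proof -
      have "\<exists>t\<in>S. \<theta> s t \<noteq> 1"
      proof (rule ccontr)
        assume "\<not> (\<exists>t\<in>S. \<theta> s t \<noteq> 1)"
        then have "s = degree_one"
          using \<theta>_row_injective [OF s degree_one(1)] \<theta>_one by auto
        then show False
          using that by simp
      qed
      then obtain t where t: "t \<in> S" "\<theta> s t \<noteq> 1"
        by blast
      have ut: "u t \<in> R t"
        using u [OF t(1)] by blast
      define a where "a = component s f * u t"
      (* both sides are the component of the same degree of f * u t = u t * f *)
      have "a = u t * component s f"
        using component_mult [OF t(1) ut s, of f] component_mult_left [OF t(1) ut s, of f]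
          central_idempotentD(2) [OF f, of "u t"] by (simp add: a_def)
      moreover have "a = \<theta> s t *s (u t * component s f)"
        unfolding a_def using quantum_commute [OF s t(1) component_in [OF s] ut] .
      ultimately have "1 *s a = \<theta> s t *s a"
        by simp
      then have "a = 0"
        using t(2) unfolding scale_cancel_right by auto
      obtain v where v: "u t * v = \<epsilon>"
        using inv [OF t(1)] by blast
      have "component s f * \<epsilon> = a * v"
        by (simp only: a_def v mult.assoc)
      then have "component s f * \<epsilon> = 0"
        using \<open>a = 0\<close> by simp
      moreover have "component s f = component s f * \<epsilon>"
        using component_mult [OF degree_one(1) \<epsilon>(2) s, of f] degree_mult_commute [OF s degree_one(1)]
          degree_one(2) [OF s] central_idempotentD(2) [OF \<epsilon>(1), of f] \<epsilon>f by simp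
      ultimately show ?thesis
        by simp
    qed
    have "f = (\<Sum>s\<in>S. component s f)"
      by (rule sum_components [symmetric])
    also have "\<dots> = (\<Sum>s\<in>{degree_one}. component s f)"
      using degree_one(1) vanish by (intro sum.mono_neutral_right) auto
    finally have "f = component degree_one f"
      by simp
    then have "f \<in> R degree_one"
      using component_in [OF degree_one(1), of f] by simp
    then obtain c where c: "f = c *s \<epsilon>"
      using line \<epsilon>f by blast
    have "(c * c) *s \<epsilon> = c *s \<epsilon>"
      using central_idempotentD(1) [OF f] central_idempotentD(1) [OF \<epsilon>(1)]
      by (simp add: c scale_mult_left scale_mult_right)
    then have "c * c = c"
      using \<epsilon>(3) unfolding scale_cancel_right by simp
    then have "c = 0 \<or> c = 1"
      by simp
    then have "f = 0 \<or> f = \<epsilon>"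
      using c by auto
    then show ?thesis
      using I' by auto
  qed
  moreover have "corner \<epsilon> \<noteq> {0}"
    using corner_self [OF \<epsilon>(1)] \<epsilon>(3) by auto
  ultimately have "simple_ideal (corner \<epsilon>)"
    unfolding simple_ideal_def using ideal_of_corner [OF \<epsilon>(1)] by blast
  then have "simple_component (corner \<epsilon>)"
    using simple_component_corner [OF \<epsilon>(1)] by blast
  then show thesis
    using that dim by blast
qed

end

theorem theorem55:
  fixes scale :: "'k::alg_closed_field \<Rightarrow> 'a::ring_1 \<Rightarrow> 'a"
    and m :: nat
    and R :: "nat \<Rightarrow> 'a set"
    and \<theta> :: "nat \<Rightarrow> nat \<Rightarrow> 'k"
  assumes char: "CHAR('k) \<noteq> 2"
    and alg: "unital_algebra scale"
    and fin_dim: "\<exists>Basis. finite_dimensional_vector_space scale Basis"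
    and semisimple: "unital_algebra.semisimple scale"
    and grading: "unital_algebra.set_grading scale {1..m} R"
    and regular: "unital_algebra.regular_quantum_commutative scale {1..m} R \<theta>"
    and minimal: "minimal_matrix {1..m} \<theta>"
  shows "\<exists>(G :: nat monoid) (B :: 'a set) (r :: nat) (n :: nat \<Rightarrow> nat).
           comm_group G \<and> finite (carrier G) \<and>
           unital_algebra.group_grading scale {1..m} R G \<and>
           unital_algebra.simple_component scale B \<and>
           m = vector_space.dim scale B \<and>
           (\<forall>i\<in>{1..r}. 0 < n i) \<and>
           G \<cong> product_group {1..r} (\<lambda>i. integer_mod_group (n i) \<times>\<times> integer_mod_group (n i)) \<and>
           real (\<Prod>i\<in>{1..r}. n i) = sqrt (real (vector_space.dim scale B))"
proof -
  interpret unital_algebra scale by (rule alg)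
  obtain Basis where "finite_dimensional_vector_space scale Basis"
    using fin_dim by blast
  then interpret V: finite_dimensional_vector_space scale Basis .
  interpret semisimple_quantum_commutative_grading scale "{1..m}" R \<theta> Basis
    by unfold_locales (fact semisimple grading regular minimal)+
  obtain B where B: "simple_component B" "dim B = m"
    using simple_component_of_dim_card by auto
  obtain r n where n: "\<forall>i\<in>{1..r}. 0 < n i" and iso: "degree_group \<cong> hyperbolic_product r n"
    using alternating_bicharacter_imp_iso_hyperbolic [OF alternating_bicharacter_degree_group] by blast
  have "m = (\<Prod>i\<in>{1..r}. n i) ^ 2"
    using iso_same_card [OF iso] unfolding card_hyperbolic_product [OF n] degree_group_simps by simp
  then have "real (\<Prod>i\<in>{1..r}. n i) = sqrt (real m)"
    by (metis of_nat_0_le_iff of_nat_power real_sqrt_unique)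
  then have sqrt: "real (\<Prod>i\<in>{1..r}. n i) = sqrt (real (dim B))"
    by (simp only: B(2))
  have fin: "finite (carrier degree_group)"
    unfolding degree_group_simps by simp
  show ?thesis
    by (intro exI conjI) (fact comm_group_degree_group fin group_grading_degree_group B(1)
      B(2) [symmetric] n iso sqrt)+
qed

end
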